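(* Let $\widetilde{P}=\{p_i,\rho_i\}_{i=1}^m\in\mathcal{E}(r_1,\dots,r_m)$ with optimal POVM $\{\Pi_i\}_{i=1}^m$ for minimum error discrimination, and let $\mathscr{R}(\widetilde{P})=\{q_i,\sigma_i\}_{i=1}^m$. Then there exist linearly independent unit vectors $|\psi_{ij}\rangle\in\mathcal{H}$ and numbers $\lambda_{ij}>0$, $\lambda'_{ij}>0$ $(1\le i\le m,\ 1\le j\le r_i)$ with $\sum_{i,j}\lambda_{ij}=\sum_{i,j}\lambda'_{ij}=1$ such that: (i) $p_i\rho_i=\sum_{j=1}^{r_i}\lambda_{ij}|\psi_{ij}\rangle\langle\psi_{ij}|$ for all $i$; (ii) the optimal POVM for minimum error discrimination of the $n$-element pure state ensemble $\{\lambda_{ij},|\psi_{ij}\rangle\langle\psi_{ij}|\}$ is of the form $\{|w_{ij}\rangle\langle w_{ij}|\}$ with $\Pi_i=\sum_{j=1}^{r_i}|w_{ij}\rangle\langle w_{ij}|$ for all $i$; (iii) $q_i\sigma_i=\sum_{j=1}^{r_i}\lambda'_{ij}|\psi_{ij}\rangle\langle\psi_{ij}|$ for all $i$, and the pretty good measurement of the pure state ensemble $\{\lambda'_{ij},|\psi_{ij}\rangle\langle\psi_{ij}|\}$ is the optimal POVM of the ensemble $\{\lambda_{ij},|\psi_{ij}\rangle\langle\psi_{ij}|\}$.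
   Context: Setting: $\mathcal{H}$ is a complex Hilbert space of finite dimension $n$; $r_1\ge r_2\ge\dots\ge r_m\ge 1$ are integers with $\sum_{i=1}^m r_i=n$. $\mathcal{E}(r_1,\dots,r_m)$ is the set of (ordered) ensembles $\{p_i,\rho_i\}_{i=1}^m$ with $p_i>0$, $\sum_i p_i=1$, $\rho_i$ density operators on $\mathcal{H}$ with $\mathrm{rank}(\rho_i)=r_i$, and supports $\mathrm{supp}(\rho_1),\dots,\mathrm{supp}(\rho_m)$ linearly independent and together spanning $\mathcal{H}$. For an ensemble with $N$ states, an $N$-element POVM is a family $\{\Pi_i\}_{i=1}^N$ with $\Pi_i\ge 0$, $\sum_i\Pi_i=\mathbb{1}$; it is optimal for minimum error discrimination (MED) of $\{p_i,\rho_i\}_{i=1}^N$ if it maximizes $\sum_i p_i\mathrm{Tr}(\rho_i\Pi_i)$ over all $N$-element POVMs. Known fact: for a linearly independent ensemble (in particular for one in $\mathcal{E}(r_1,\dots,r_m)$) the optimal POVM is unique and is a projective measurement with $\mathrm{rank}(\Pi_i)=\mathrm{rank}(\rho_i)$. The pretty good measurement of an ensemble $\{q_i,\sigma_i\}$ with $S=\sum_j q_j\sigma_j>0$ is the POVM $\{S^{-1/2}q_i\sigma_iS^{-1/2}\}_i$. Definition of $\mathscr{R}$: given $\widetilde{P}=\{p_i,\rho_i\}\in\mathcal{E}(r_1,\dots,r_m)$ with optimal POVM $\{\Pi_i\}$, choose a decomposition $p_i\rho_i=\sum_{j=1}^{r_i}|\widetilde{\psi}_{ij}\rangle\langle\widetilde{\psi}_{ij}|$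 into unnormalized pure states for each $i$, and an orthonormal basis $\{|v_{ij}\rangle\}_{j=1}^{r_i}$ of $\mathrm{supp}(\Pi_i)$ such that the $r_i\times r_i$ matrix $(X^{(ii)})_{jk}=\langle\widetilde{\psi}_{ij}|v_{ik}\rangle$ is positive semidefinite (it is then positive definite). Put $|\widetilde{\chi}_{ij}\rangle=\sum_{k=1}^{r_i}(X^{(ii)})_{kj}|\widetilde{\psi}_{ik}\rangle$ and $N=\sum_{l=1}^m\sum_{k=1}^{r_l}\langle\widetilde{\chi}_{lk}|\widetilde{\chi}_{lk}\rangle$. Then $\mathscr{R}(\widetilde{P})=\{q_i,\sigma_i\}_{i=1}^m$, where $q_i\sigma_i=\frac1N\sum_{j=1}^{r_i}|\widetilde{\chi}_{ij}\rangle\langle\widetilde{\chi}_{ij}|$, $q_i=\mathrm{Tr}(q_i\sigma_i)$. The result does not depend on the choices and lies in $\mathcal{E}(r_1,\dots,r_m)$. *)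

theory Defs
  imports "HOL-Analysis.Analysis"
begin

text \<open>The Hilbert space is \<open>complex ^ 'n\<close>, of dimension \<open>CARD('n)\<close>. The library's
  \<open>inner\<close> is only the real part of \<open>cinner\<close>, while the library norm satisfies
  \<open>(norm x)\<^sup>2 = cinner x x\<close>. Complex-linear span and independence are
  \<open>vec.span\<close> and \<open>vec.independent\<close>; the unqualified constants are the real-linear ones.\<close>

text \<open>Conjugate-linear in the first argument: \<open>cinner x y\<close> is the bracket of bra \<open>x\<close> and ket \<open>y\<close>.\<close>

definition cinner :: "complex ^ 'n \<Rightarrow> complex ^ 'n \<Rightarrow> complex" where
  "cinner x y = (\<Sum>i\<in>UNIV. cnj (x $ i) * y $ i)"

definition ketbra :: "complex ^ 'n \<Rightarrow> complex ^ 'n \<Rightarrow> complex ^ 'n ^ 'n" where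
  "ketbra x y = (\<chi> i j. x $ i * cnj (y $ j))"

definition cadjoint :: "complex ^ 'n ^ 'n \<Rightarrow> complex ^ 'n ^ 'n" where
  "cadjoint A = (\<chi> i j. cnj (A $ j $ i))"

definition psd :: "complex ^ 'n ^ 'n \<Rightarrow> bool" where
  "psd A \<longleftrightarrow> cadjoint A = A \<and> (\<forall>x. 0 \<le> Re (cinner x (A *v x)))"

text \<open>Positive semidefiniteness of a matrix whose rows and columns are indexed by a finite set \<open>J\<close>.\<close>

definition psd_on :: "'j set \<Rightarrow> ('j \<Rightarrow> 'j \<Rightarrow> complex) \<Rightarrow> bool" where
  "psd_on J X \<longleftrightarrow> (\<forall>j\<in>J. \<forall>k\<in>J. X k j = cnj (X j k)) \<and>
     (\<forall>c. 0 \<le> Re (\<Sum>j\<in>J. \<Sum>k\<in>J. cnj (c j) * X j k * c k))"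

definition density_operator :: "complex ^ 'n ^ 'n \<Rightarrow> bool" where
  "density_operator \<rho> \<longleftrightarrow> psd \<rho> \<and> trace \<rho> = 1"

text \<open>Orthogonal complement of the kernel.\<close>

definition supp :: "complex ^ 'n ^ 'n \<Rightarrow> (complex ^ 'n) set" where
  "supp A = {x. \<forall>y. A *v y = 0 \<longrightarrow> cinner x y = 0}"

definition independent_subspaces :: "'i set \<Rightarrow> ('i \<Rightarrow> (complex ^ 'n) set) \<Rightarrow> bool" where
  "independent_subspaces I V \<longleftrightarrow>
     (\<forall>x. (\<forall>i\<in>I. x i \<in> V i) \<and> (\<Sum>i\<in>I. x i) = 0 \<longrightarrow> (\<forall>i\<in>I. x i = 0))"

definition independent_family :: "'i set \<Rightarrow> ('i \<Rightarrow> complex ^ 'n) \<Rightarrow> bool" where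
  "independent_family I \<psi> \<longleftrightarrow> inj_on \<psi> I \<and> vec.independent (\<psi> ` I)"

definition ensemble :: "'i set \<Rightarrow> ('i \<Rightarrow> real) \<Rightarrow> ('i \<Rightarrow> complex ^ 'n ^ 'n) \<Rightarrow> bool" where
  "ensemble I p \<rho> \<longleftrightarrow> finite I \<and> (\<forall>i\<in>I. 0 < p i) \<and> (\<Sum>i\<in>I. p i) = 1 \<and>
     (\<forall>i\<in>I. density_operator (\<rho> i))"

text \<open>The class \<open>\<E>(r\<^sub>1, \<dots>, r\<^sub>m)\<close>; the conditions on the numbers \<open>r i\<close> themselves (decreasing, at
  least 1, with sum \<open>CARD('n)\<close>) are not part of this predicate.\<close>

definition in_E ::
  "nat \<Rightarrow> (nat \<Rightarrow> nat) \<Rightarrow> (nat \<Rightarrow> real) \<Rightarrow> (nat \<Rightarrow> complex ^ 'n ^ 'n) \<Rightarrow> bool" where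
  "in_E m r p \<rho> \<longleftrightarrow> ensemble {1..m} p \<rho> \<and> (\<forall>i\<in>{1..m}. rank (\<rho> i) = r i) \<and>
     independent_subspaces {1..m} (\<lambda>i. supp (\<rho> i)) \<and>
     vec.span (\<Union>i\<in>{1..m}. supp (\<rho> i)) = UNIV"

definition POVM :: "'i set \<Rightarrow> ('i \<Rightarrow> complex ^ 'n ^ 'n) \<Rightarrow> bool" where
  "POVM I M \<longleftrightarrow> (\<forall>i\<in>I. psd (M i)) \<and> (\<Sum>i\<in>I. M i) = mat 1"

definition success_prob ::
  "'i set \<Rightarrow> ('i \<Rightarrow> real) \<Rightarrow> ('i \<Rightarrow> complex ^ 'n ^ 'n) \<Rightarrow> ('i \<Rightarrow> complex ^ 'n ^ 'n) \<Rightarrow> real" where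
  "success_prob I p \<rho> M = (\<Sum>i\<in>I. p i * Re (trace (\<rho> i ** M i)))"

definition optimal_POVM ::
  "'i set \<Rightarrow> ('i \<Rightarrow> real) \<Rightarrow> ('i \<Rightarrow> complex ^ 'n ^ 'n) \<Rightarrow> ('i \<Rightarrow> complex ^ 'n ^ 'n) \<Rightarrow> bool" where
  "optimal_POVM I p \<rho> M \<longleftrightarrow> POVM I M \<and>
     (\<forall>M'. POVM I M' \<longrightarrow> success_prob I p \<rho> M' \<le> success_prob I p \<rho> M)"

text \<open>\<open>M\<close> is optimal and, as a family over \<open>I\<close>, the only optimal POVM.\<close>

definition the_optimal_POVM ::
  "'i set \<Rightarrow> ('i \<Rightarrow> real) \<Rightarrow> ('i \<Rightarrow> complex ^ 'n ^ 'n) \<Rightarrow> ('i \<Rightarrow> complex ^ 'n ^ 'n) \<Rightarrow> bool" where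
  "the_optimal_POVM I p \<rho> M \<longleftrightarrow> optimal_POVM I p \<rho> M \<and>
     (\<forall>M'. optimal_POVM I p \<rho> M' \<longrightarrow> (\<forall>i\<in>I. M' i = M i))"

text \<open>Specified only for positive semidefinite arguments.\<close>

definition msqrt :: "complex ^ 'n ^ 'n \<Rightarrow> complex ^ 'n ^ 'n" where
  "msqrt A = (THE B. psd B \<and> B ** B = A)"

text \<open>Meaningful when \<open>\<Sum>j\<in>I. q j *\<^sub>R \<sigma> j\<close> is positive definite.\<close>

definition PGM ::
  "'i set \<Rightarrow> ('i \<Rightarrow> real) \<Rightarrow> ('i \<Rightarrow> complex ^ 'n ^ 'n) \<Rightarrow> 'i \<Rightarrow> complex ^ 'n ^ 'n" where
  "PGM I q \<sigma> i =
     (let T = matrix_inv (msqrt (\<Sum>j\<in>I. q j *\<^sub>R \<sigma> j)) in T ** (q i *\<^sub>R \<sigma> i) ** T)"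

definition onb_of :: "nat \<Rightarrow> (nat \<Rightarrow> complex ^ 'n) \<Rightarrow> (complex ^ 'n) set \<Rightarrow> bool" where
  "onb_of d v V \<longleftrightarrow>
     (\<forall>j\<in>{1..d}. \<forall>k\<in>{1..d}. cinner (v j) (v k) = (if j = k then 1 else 0)) \<and>
     vec.span (v ` {1..d}) = V"

text \<open>The map \<open>\<R>\<close> is given as a relation: \<open>\<R>_rel m r p \<rho> q \<sigma>\<close> holds iff some admissible choice of
  \<open>\<psi>\<close> and \<open>v\<close> produces \<open>{q\<^sub>i, \<sigma>\<^sub>i}\<close> from \<open>{p\<^sub>i, \<rho>\<^sub>i}\<close>. Here \<open>\<psi> i j\<close>, \<open>chi i j\<close> are the unnormalized
  vectors and \<open>X i\<close> is the \<open>i\<close>-th diagonal block.\<close>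

definition \<R>_rel ::
  "nat \<Rightarrow> (nat \<Rightarrow> nat) \<Rightarrow> (nat \<Rightarrow> real) \<Rightarrow> (nat \<Rightarrow> complex ^ 'n ^ 'n) \<Rightarrow>
   (nat \<Rightarrow> real) \<Rightarrow> (nat \<Rightarrow> complex ^ 'n ^ 'n) \<Rightarrow> bool" where
  "\<R>_rel m r p \<rho> q \<sigma> \<longleftrightarrow>
    (\<exists>M \<psi> v. optimal_POVM {1..m} p \<rho> M \<and>
      (\<forall>i\<in>{1..m}. p i *\<^sub>R \<rho> i = (\<Sum>j\<in>{1..r i}. ketbra (\<psi> i j) (\<psi> i j))) \<and>
      (\<forall>i\<in>{1..m}. onb_of (r i) (v i) (supp (M i))) \<and>
      (let X = (\<lambda>i j k. cinner (\<psi> i j) (v i k));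
           chi = (\<lambda>i j. \<Sum>k\<in>{1..r i}. X i k j *s \<psi> i k);
           N = (\<Sum>l\<in>{1..m}. \<Sum>k\<in>{1..r l}. Re (cinner (chi l k) (chi l k)))
       in (\<forall>i\<in>{1..m}. psd_on {1..r i} (X i)) \<and>
          (\<forall>i\<in>{1..m}. q i *\<^sub>R \<sigma> i = (1 / N) *\<^sub>R (\<Sum>j\<in>{1..r i}. ketbra (chi i j) (chi i j)) \<and>
             q i = Re (trace (q i *\<^sub>R \<sigma> i)))))"

end

theory Submission
  imports Defs
begin

text \<open>Write \<open>A\<^sub>i = p\<^sub>i \<rho>\<^sub>i\<close> and \<open>Z = \<Sum>\<^sub>i A\<^sub>i M\<^sub>i\<close>. Optimality of \<open>M\<close> is equivalent to \<open>Z \<ge> A\<^sub>i\<close> for all \<open>i\<close>,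
  and then \<open>A\<^sub>i M\<^sub>i = Z M\<^sub>i\<close>. As \<open>Z\<close> is invertible and the supports are independent, this makes
  \<open>M\<close> unique and projective. The vectors of \<open>\<R>\<close> are \<open>\<chi>\<^sub>i\<^sub>j = A\<^sub>i v\<^sub>i\<^sub>j\<close>, so
  \<open>q\<^sub>i \<sigma>\<^sub>i = N\<^sup>-\<^sup>1 A\<^sub>i M\<^sub>i A\<^sub>i = N\<^sup>-\<^sup>1 Z M\<^sub>i Z\<close> for every choice of \<open>\<psi>\<close> and \<open>v\<close>. In each \<open>supp M\<^sub>i\<close> take an
  orthonormal basis \<open>w\<^sub>i\<^sub>j\<close> that diagonalizes the form of \<open>Z\<close>, with diagonal entries \<open>e\<^sub>i\<^sub>j\<close>. Then
  \<open>A\<^sub>i = \<Sum>\<^sub>j e\<^sub>i\<^sub>j\<^sup>-\<^sup>1 |Z w\<^sub>i\<^sub>j\<rangle>\<langle>Z w\<^sub>i\<^sub>j|\<close> and \<open>q\<^sub>i \<sigma>\<^sub>i = N\<^sup>-\<^sup>1 \<Sum>\<^sub>j |Z w\<^sub>i\<^sub>j\<rangle>\<langle>Z w\<^sub>i\<^sub>j|\<close>; normalizing the \<open>Z w\<^sub>i\<^sub>j\<close>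
  gives the \<open>\<psi>\<^sub>i\<^sub>j\<close>. The same \<open>Z\<close> certifies that \<open>|w\<^sub>i\<^sub>j\<rangle>\<langle>w\<^sub>i\<^sub>j|\<close> is optimal for the refined ensemble,
  and it is the pretty good measurement because \<open>Z / \<surd>N\<close> is the square root of
  \<open>\<Sum>\<^sub>i q\<^sub>i \<sigma>\<^sub>i\<close>.\<close>

subsection \<open>Sesquilinear algebra\<close>

lemma cinner_add_left: "cinner (x + y) z = cinner x z + cinner y z"
  by (simp add: cinner_def distrib_right sum.distrib)

lemma cinner_add_right: "cinner x (y + z) = cinner x y + cinner x z"
  by (simp add: cinner_def distrib_left sum.distrib)

lemma cinner_diff_left: "cinner (x - y) z = cinner x z - cinner y z"
  by (simp add: cinner_def left_diff_distrib sum_subtractf)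

lemma cinner_diff_right: "cinner x (y - z) = cinner x y - cinner x z"
  by (simp add: cinner_def right_diff_distrib sum_subtractf)

lemma cinner_scale_left: "cinner (c *s x) y = cnj c * cinner x y"
  by (simp add: cinner_def sum_distrib_left mult.assoc)

lemma cinner_scale_right: "cinner x (c *s y) = c * cinner x y"
  by (simp add: cinner_def sum_distrib_left mult.left_commute)

lemma cinner_zero_left [simp]: "cinner 0 x = 0"
  by (simp add: cinner_def)

lemma cinner_zero_right [simp]: "cinner x 0 = 0"
  by (simp add: cinner_def)

lemma cinner_sum_right: "cinner x (\<Sum>i\<in>I. f i) = (\<Sum>i\<in>I. cinner x (f i))"
  by (induction I rule: infinite_finite_induct) (simp_all add: cinner_add_right)

lemma cnj_cinner: "cnj (cinner x y) = cinner y x"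
  by (simp add: cinner_def mult.commute)

lemma cinner_self: "cinner x x = of_real ((norm x)\<^sup>2)"
proof -
  have "cinner x x = (\<Sum>i\<in>UNIV. of_real ((norm (x $ i))\<^sup>2))"
    by (simp add: cinner_def complex_norm_square mult.commute del: of_real_power)
  also have "\<dots> = of_real ((norm x)\<^sup>2)"
    by (simp add: norm_vec_def L2_set_def sum_nonneg)
  finally show ?thesis .
qed

lemma cinner_self_eq_0 [simp]: "cinner x x = 0 \<longleftrightarrow> x = 0"
  by (simp add: cinner_self)

lemma scaleR_eq_scale: "c *\<^sub>R x = of_real c *s (x :: complex ^ 'n)"
  by (simp add: vec_eq_iff scaleR_conv_of_real[where 'a = complex])

lemma cinner_adjoint: "cinner x (A *v y) = cinner (cadjoint A *v x) y"
proof -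
  have "cinner x (A *v y) = (\<Sum>i\<in>UNIV. \<Sum>j\<in>UNIV. cnj (x $ i) * A $ i $ j * y $ j)"
    by (simp add: cinner_def matrix_vector_mult_def sum_distrib_left mult.assoc)
  also have "\<dots> = (\<Sum>j\<in>UNIV. \<Sum>i\<in>UNIV. cnj (x $ i) * A $ i $ j * y $ j)"
    by (rule sum.swap)
  also have "\<dots> = cinner (cadjoint A *v x) y"
    by (simp add: cinner_def cadjoint_def matrix_vector_mult_def sum_distrib_left sum_distrib_right ac_simps)
  finally show ?thesis .
qed

lemma cadjoint_cadjoint [simp]: "cadjoint (cadjoint A) = A"
  by (simp add: cadjoint_def vec_eq_iff)

lemma cadjoint_add: "cadjoint (A + B) = cadjoint A + cadjoint B"
  by (simp add: cadjoint_def vec_eq_iff)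

lemma cadjoint_diff: "cadjoint (A - B) = cadjoint A - cadjoint B"
  by (simp add: cadjoint_def vec_eq_iff)

lemma cadjoint_scaleR: "cadjoint (c *\<^sub>R A) = c *\<^sub>R cadjoint A"
  by (simp add: cadjoint_def vec_eq_iff)

lemma cadjoint_0 [simp]: "cadjoint 0 = 0"
  by (simp add: cadjoint_def vec_eq_iff)

lemma cadjoint_sum: "cadjoint (\<Sum>i\<in>I. f i) = (\<Sum>i\<in>I. cadjoint (f i))"
  by (induction I rule: infinite_finite_induct) (simp_all add: cadjoint_add)

lemma cadjoint_mult: "cadjoint (A ** B) = cadjoint B ** cadjoint A"
  by (simp add: cadjoint_def matrix_matrix_mult_def vec_eq_iff mult.commute)

lemma cadjoint_mat_1 [simp]: "cadjoint (mat 1) = mat 1"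
  by (auto simp: cadjoint_def mat_def vec_eq_iff)

lemma cadjoint_ketbra: "cadjoint (ketbra x y) = ketbra y x"
  by (simp add: cadjoint_def ketbra_def vec_eq_iff mult.commute)

lemma ketbra_mult_vec: "ketbra x y *v z = cinner y z *s x"
  by (simp add: ketbra_def cinner_def matrix_vector_mult_def vec_eq_iff sum_distrib_left
      sum_distrib_right ac_simps)

lemma sum_matrix_mult_vec: "(\<Sum>i\<in>I. A i) *v x = (\<Sum>i\<in>I. A i *v x)"
  by (induction I rule: infinite_finite_induct) (simp_all add: matrix_vector_mult_add_rdistrib)

lemma matrix_mult_vec_sum: "A *v (\<Sum>i\<in>I. f i) = (\<Sum>i\<in>I. A *v f i)"
  for A :: "complex ^ 'n ^ 'm"
  by (induction I rule: infinite_finite_induct) (simp_all add: matrix_vector_right_distrib)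

lemma scaleR_matrix_mult_vec: "(c *\<^sub>R A) *v x = of_real c *s (A *v x)" for A :: "complex ^ 'n ^ 'm"
  by (simp add: matrix_vector_mult_def vec_eq_iff sum_distrib_left mult.assoc scaleR_conv_of_real[where 'a = complex])

lemma matrix_mult_vec_scale: "A *v (c *s x) = c *s (A *v x)" for A :: "complex ^ 'n ^ 'm"
  by (simp add: matrix_vector_mult_def vec_eq_iff sum_distrib_left ac_simps)

lemma matrix_diff_ldistrib: "A ** (B - C) = A ** B - A ** C" for A :: "complex ^ 'n ^ 'm"
  by (simp add: matrix_eq matrix_vector_mult_diff_rdistrib matrix_vector_mult_diff_distrib
      flip: matrix_vector_mul_assoc)

lemma matrix_diff_rdistrib: "(A - B) ** C = A ** C - B ** C" for A :: "complex ^ 'n ^ 'm"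
  by (simp add: matrix_eq matrix_vector_mult_diff_rdistrib flip: matrix_vector_mul_assoc)

lemma matrix_sum_ldistrib: "A ** (\<Sum>i\<in>I. B i) = (\<Sum>i\<in>I. A ** B i)" for A :: "complex ^ 'n ^ 'm"
  by (simp add: matrix_eq sum_matrix_mult_vec matrix_mult_vec_sum flip: matrix_vector_mul_assoc)

lemma matrix_sum_rdistrib: "(\<Sum>i\<in>I. B i) ** A = (\<Sum>i\<in>I. B i ** A)" for A :: "complex ^ 'n ^ 'm"
  by (simp add: matrix_eq sum_matrix_mult_vec flip: matrix_vector_mul_assoc)

lemma scaleR_matrix_mult_left: "(c *\<^sub>R A) ** B = c *\<^sub>R (A ** B)" for A :: "complex ^ 'n ^ 'm"
  by (simp add: matrix_eq scaleR_matrix_mult_vec flip: matrix_vector_mul_assoc)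

lemma scaleR_matrix_mult_right: "A ** (c *\<^sub>R B) = c *\<^sub>R (A ** B)" for A :: "complex ^ 'n ^ 'm"
  by (simp add: matrix_eq scaleR_matrix_mult_vec matrix_mult_vec_scale flip: matrix_vector_mul_assoc)

lemma matrix_mult_ketbra: "A ** ketbra x y = ketbra (A *v x) y"
  by (simp add: matrix_eq ketbra_mult_vec matrix_mult_vec_scale flip: matrix_vector_mul_assoc)

lemma ketbra_matrix_mult: "ketbra x y ** A = ketbra x (cadjoint A *v y)"
  by (simp add: matrix_eq ketbra_mult_vec cinner_adjoint flip: matrix_vector_mul_assoc)

lemma ketbra_scaleR: "ketbra (c *\<^sub>R x) (c *\<^sub>R x) = (c\<^sup>2) *\<^sub>R ketbra x x"
  by (simp add: ketbra_def vec_eq_iff power2_eq_square scaleR_conv_of_real[where 'a = complex])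

lemma trace_ketbra: "trace (ketbra x y) = cinner y x"
  by (simp add: trace_def ketbra_def cinner_def mult.commute)

lemma trace_diff: "trace (A - B) = trace A - trace B" for A :: "complex ^ 'n ^ 'n"
  by (simp add: trace_def sum_subtractf)

lemma trace_scaleR: "trace (c *\<^sub>R A) = of_real c * trace A" for A :: "complex ^ 'n ^ 'n"
  by (simp add: trace_def sum_distrib_left scaleR_conv_of_real[where 'a = complex])

lemma trace_sum: "trace (\<Sum>i\<in>I. A i) = (\<Sum>i\<in>I. trace (A i))" for A :: "'i \<Rightarrow> complex ^ 'n ^ 'n"
  by (simp add: trace_def sum.swap[of _ I])

lemma trace_cadjoint: "trace (cadjoint A) = cnj (trace A)"
  by (simp add: trace_def cadjoint_def)

section \<open>Positive semidefinite matrices\<close>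

lemma psd_cadjoint: "psd A \<Longrightarrow> cadjoint A = A"
  by (simp add: psd_def)

lemma psd_cinner_nonneg: "psd A \<Longrightarrow> 0 \<le> Re (cinner x (A *v x))"
  by (simp add: psd_def)

lemma hermitian_cinner: "cadjoint A = A \<Longrightarrow> cinner x (A *v y) = cinner (A *v x) y"
  by (simp add: cinner_adjoint)

lemma hermitian_quadratic_real:
  assumes "cadjoint A = A"
  shows "cinner x (A *v x) = of_real (Re (cinner x (A *v x)))"
proof -
  have "cnj (cinner x (A *v x)) = cinner x (A *v x)"
    by (simp add: cnj_cinner hermitian_cinner[OF assms])
  then show ?thesis
    by (simp add: complex_eq_iff)
qed

lemma psd_add: "psd A \<Longrightarrow> psd B \<Longrightarrow> psd (A + B)"
  by (simp add: psd_def cadjoint_add matrix_vector_mult_add_rdistrib cinner_add_right)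

lemma psd_0 [simp]: "psd 0"
  by (simp add: psd_def)

lemma psd_sum: "(\<And>i. i \<in> I \<Longrightarrow> psd (A i)) \<Longrightarrow> psd (\<Sum>i\<in>I. A i)"
  by (induction I rule: infinite_finite_induct) (simp_all add: psd_add)

lemma psd_scaleR: "psd A \<Longrightarrow> 0 \<le> c \<Longrightarrow> psd (c *\<^sub>R A)"
  by (simp add: psd_def cadjoint_scaleR scaleR_matrix_mult_vec cinner_scale_right)

lemma psd_conjugate: "psd A \<Longrightarrow> psd (B ** A ** cadjoint B)"
  by (simp add: psd_def cadjoint_mult matrix_mul_assoc)
    (metis cadjoint_cadjoint cinner_adjoint matrix_vector_mul_assoc)

lemma psd_ketbra: "psd (ketbra x x)"
proof -
  have "cinner z x * cinner x z = of_real ((cmod (cinner x z))\<^sup>2)" for z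
    by (metis cnj_cinner complex_norm_square mult.commute)
  then show ?thesis
    by (simp add: psd_def cadjoint_ketbra ketbra_mult_vec cinner_scale_right mult.commute)
qed

text \<open>With \<open>c = \<langle>y, B x\<rangle>\<close>, the function \<open>t \<mapsto> \<langle>x + t c y, B (x + t c y)\<rangle>\<close> is nonnegative and vanishes
  at \<open>t = 0\<close>, so its derivative there, \<open>2 |c|\<^sup>2\<close>, is zero.\<close>

lemma null_vector_of_nonneg_form:
  assumes herm: "cadjoint B = B" and V: "vec.subspace V"
    and nonneg: "\<And>z. z \<in> V \<Longrightarrow> 0 \<le> Re (cinner z (B *v z))"
    and x: "x \<in> V" and null: "Re (cinner x (B *v x)) = 0" and y: "y \<in> V"
  shows "cinner y (B *v x) = 0"
proof (rule ccontr)
  define c where "c = cinner y (B *v x)"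
  define b where "b = Re (cinner y (B *v y))"
  \<comment> \<open>The minimizer of \<open>2 * t + t\<^sup>2 * b\<close> would be
    \<open>- 1 / b\<close>; adding 1 to the denominator keeps it defined at \<open>b = 0\<close> and
    still gives a negative value.\<close>
  define t where "t = - 1 / (b + 1)"
  assume "cinner y (B *v x) \<noteq> 0"
  then have c: "(cmod c)\<^sup>2 > 0" by (simp add: c_def)
  have b: "b \<ge> 0" using nonneg[OF y] by (simp add: b_def)
  have xy: "cinner x (B *v y) = cnj c"
    by (simp add: c_def cnj_cinner hermitian_cinner[OF herm])
  define z where "z = x + (of_real t * c) *s y"
  have z: "z \<in> V"
    unfolding z_def using V x y by (intro vec.subspace_add vec.subspace_scale)
  have cc: "c * cnj c = of_real ((cmod c)\<^sup>2)"
    by (simp add: complex_norm_square del: of_real_power)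
  have "cinner z (B *v z) = cinner x (B *v x) + of_real t * (c * cnj c) + of_real t * (c * cnj c)
      + of_real (t\<^sup>2) * (c * cnj c) * cinner y (B *v y)"
    unfolding z_def
    by (simp add: matrix_vector_right_distrib matrix_mult_vec_scale cinner_add_left cinner_add_right
        cinner_scale_left cinner_scale_right xy power2_eq_square algebra_simps flip: c_def)
  then have "Re (cinner z (B *v z)) = (cmod c)\<^sup>2 * (2 * t + t\<^sup>2 * b)"
    unfolding cc using null by (simp add: b_def algebra_simps flip: of_real_power)
  then have "0 \<le> (cmod c)\<^sup>2 * (2 * t + t\<^sup>2 * b)"
    using nonneg[OF z] by simp
  then have "0 \<le> 2 * t + t\<^sup>2 * b"
    using c by (simp add: zero_le_mult_iff)
  moreover have "2 * t + t\<^sup>2 * b = - (b + 2) / (b + 1)\<^sup>2"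
    using b by (simp add: t_def power2_eq_square divide_simps)
  moreover have "- (b + 2) / (b + 1)\<^sup>2 < 0"
    using b by (simp add: divide_neg_pos)
  ultimately show False by simp
qed

text \<open>Taking \<open>y = A *v x\<close> and the whole space in the preceding lemma makes
  \<open>A *v x\<close> orthogonal to itself.\<close>

lemma psd_null_vector:
  assumes "psd A" and "Re (cinner x (A *v x)) = 0"
  shows "A *v x = 0"
proof -
  have "cinner (A *v x) (A *v x) = 0"
    by (rule null_vector_of_nonneg_form[where V = UNIV])
      (use assms in \<open>simp_all add: psd_def\<close>)
  then show ?thesis by simp
qed

subsection \<open>Spectral theory\<close>

lemma independent_familyI:
  assumes "finite J" and 0: "\<And>c. (\<Sum>j\<in>J. c j *s \<phi> j) = 0 \<Longrightarrow> \<forall>j\<in>J. c j = 0"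
  shows "independent_family J \<phi>"
proof -
  have inj: "inj_on \<phi> J"
  proof (rule inj_onI, rule ccontr)
    fix a b assume ab: "a \<in> J" "b \<in> J" "\<phi> a = \<phi> b" "a \<noteq> b"
    \<comment> \<open>Equal members at distinct indices satisfy the relation with coefficients 1 and
      -1, so the coefficient test also rules out repetitions.\<close>
    define c :: "'a \<Rightarrow> complex" where "c = (\<lambda>j. if j = a then 1 else if j = b then -1 else 0)"
    have "(\<Sum>j\<in>J. c j *s \<phi> j) = (\<Sum>j\<in>{a, b}. c j *s \<phi> j)"
      by (rule sum.mono_neutral_right) (use ab assms in \<open>auto simp: c_def\<close>)
    also have "\<dots> = 0"
      using ab by (simp add: c_def)
    finally show False
      using 0 ab by (force simp: c_def)
  qed
  have "vec.independent (\<phi> ` J)"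
  proof (rule vec.independent_if_scalars_zero)
    fix f x assume "(\<Sum>x\<in>\<phi> ` J. f x *s x) = 0" and x: "x \<in> \<phi> ` J"
    then have "(\<Sum>j\<in>J. f (\<phi> j) *s \<phi> j) = 0"
      by (simp add: sum.reindex[OF inj])
    from 0[OF this] show "f x = 0" using x by auto
  qed (use assms in simp)
  with inj show ?thesis by (simp add: independent_family_def)
qed

text \<open>Unlike \<open>onb_of\<close>, this allows any index set and names no span: the bases of
  the separate supports are later merged into one family over pairs.\<close>

definition orthonormal_on :: "'j set \<Rightarrow> ('j \<Rightarrow> complex ^ 'n) \<Rightarrow> bool" where
  "orthonormal_on J w \<longleftrightarrow> (\<forall>j\<in>J. \<forall>k\<in>J. cinner (w j) (w k) = (if j = k then 1 else 0))"

lemma cinner_orthonormal_combination: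
  assumes "finite J" "orthonormal_on J w" "k \<in> J"
  shows "cinner (w k) (\<Sum>j\<in>J. c j *s w j) = c k"
proof -
  have "cinner (w k) (\<Sum>j\<in>J. c j *s w j) = (\<Sum>j\<in>J. if k = j then c j else 0)"
    unfolding cinner_sum_right
    by (rule sum.cong) (use assms in \<open>auto simp: cinner_scale_right orthonormal_on_def\<close>)
  then show ?thesis using assms by simp
qed

lemma orthonormal_independent:
  assumes "finite J" "orthonormal_on J w"
  shows "independent_family J w"
  using cinner_orthonormal_combination[OF assms]
  by (intro independent_familyI) (use assms in \<open>auto, metis cinner_zero_right\<close>)

lemma orthonormal_expansion:
  assumes J: "finite J" and w: "orthonormal_on J w" and x: "x \<in> vec.span (w ` J)"
  shows "x = (\<Sum>j\<in>J. cinner (w j) x *s w j)"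
proof -
  have inj: "inj_on w J"
    using orthonormal_independent[OF J w] by (simp add: independent_family_def)
  obtain u where "x = (\<Sum>v\<in>w ` J. u v *s v)"
    using x J by (auto simp: vec.span_finite)
  then have "x = (\<Sum>j\<in>J. u (w j) *s w j)"
    by (simp add: sum.reindex[OF inj])
  then show ?thesis
    using cinner_orthonormal_combination[OF J w, where c = "\<lambda>j. u (w j)"] by simp
qed

lemma orthonormal_on_dim:
  assumes "finite J" "orthonormal_on J w"
  shows "vec.dim (vec.span (w ` J)) = card J"
  using orthonormal_independent[OF assms]
  by (simp add: independent_family_def vec.dim_span_eq_card_independent card_image del: vec.dim_span)

text \<open>The form is continuous and the unit sphere of \<open>V\<close> is compact, so a maximum
  is attained; homogeneity of degree two extends the bound from the sphere to
  \<open>V\<close>.\<close>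

lemma hermitian_max_on_sphere:
  fixes V :: "(complex ^ 'n) set"
  assumes V: "vec.subspace V" and nz: "V \<noteq> {0}"
  shows "\<exists>x\<in>V. norm x = 1 \<and>
    (\<forall>y\<in>V. Re (cinner y (A *v y)) \<le> Re (cinner x (A *v x)) * (norm y)\<^sup>2)"
proof -
  define Q where "Q = (\<lambda>y. Re (cinner y (A *v y)))"
  \<comment> \<open>It is as a real subspace that \<open>V\<close> is known to be closed.\<close>
  have subV: "subspace V"
    using V by (auto simp: subspace_def vec.subspace_def scaleR_eq_scale)
  have Q_scale: "Q (c *\<^sub>R y) = c\<^sup>2 * Q y" for c y
    by (simp add: Q_def scaleR_eq_scale matrix_mult_vec_scale cinner_scale_left
        cinner_scale_right power2_eq_square mult.assoc)
  have "continuous_on UNIV Q"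
    unfolding Q_def cinner_def matrix_vector_mult_def by (intro continuous_intros)
  then have cont: "continuous_on (sphere 0 1 \<inter> V) Q"
    by (rule continuous_on_subset) simp
  have comp: "compact (sphere 0 1 \<inter> V)"
    using closed_subspace[OF subV] by (intro compact_Int_closed) auto
  obtain v where v: "v \<in> V" "v \<noteq> 0"
    using nz V by (auto simp: vec.subspace_def)
  then have "(1 / norm v) *\<^sub>R v \<in> sphere 0 1 \<inter> V"
    using subV by (auto simp: subspace_def)
  then have "sphere 0 1 \<inter> V \<noteq> {}" by blast
  then obtain x where x: "x \<in> V" "norm x = 1"
    and max: "\<And>y. y \<in> V \<Longrightarrow> norm y = 1 \<Longrightarrow> Q y \<le> Q x"
    using continuous_attains_sup[OF comp _ cont] by fastforce
  have "Q y \<le> Q x * (norm y)\<^sup>2" if y: "y \<in> V" for y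
  proof (cases "y = 0")
    case True
    then show ?thesis by (simp add: Q_def)
  next
    case False
    have "Q ((1 / norm y) *\<^sub>R y) \<le> Q x"
      using False y subV by (intro max) (auto simp: subspace_def)
    then show ?thesis
      using False unfolding Q_scale by (simp add: field_simps)
  qed
  with x show ?thesis by (auto simp: Q_def)
qed

text \<open>Induction on the dimension: split off a maximizer \<open>x\<close> of the form on the
  unit sphere and pass to its orthogonal complement in \<open>V\<close>. What is diagonalized is the
  form on \<open>V\<close>, not the operator: \<open>A\<close> may move \<open>V\<close>, as
  \<open>Z\<close> may move \<open>supp (M i)\<close>.\<close>

lemma diagonalizing_orthonormal_basis:
  fixes V :: "(complex ^ 'n) set"
  assumes "vec.subspace V" and herm: "cadjoint A = A"
  shows "\<exists>(d::nat) w. orthonormal_on {1..d} w \<and> vec.span (w ` {1..d}) = V \<and>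
    (\<forall>j\<in>{1..d}. \<forall>k\<in>{1..d}. j \<noteq> k \<longrightarrow> cinner (w j) (A *v w k) = 0)"
  using assms(1)
proof (induction "vec.dim V" arbitrary: V rule: less_induct)
  case less
  note V = less.prems
  show ?case
  proof (cases "V = {0}")
    case True
    then show ?thesis
      by (intro exI[of _ 0]) (auto simp: orthonormal_on_def)
  next
    case False
    obtain x where x: "x \<in> V" "norm x = 1"
      and max: "\<And>y. y \<in> V \<Longrightarrow> Re (cinner y (A *v y)) \<le> Re (cinner x (A *v x)) * (norm y)\<^sup>2"
      using hermitian_max_on_sphere[OF V False, of A] by auto
    have xx: "cinner x x = 1" using x by (simp add: cinner_self)
    define \<mu> where "\<mu> = Re (cinner x (A *v x))"
    \<comment> \<open>Maximality makes the form of \<open>B\<close> nonnegative on \<open>V\<close>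
      with null vector \<open>x\<close>; hence \<open>A *v x\<close> is orthogonal to every vector
      of \<open>V\<close> that is orthogonal to \<open>x\<close>.\<close>
    define B where "B = \<mu> *\<^sub>R mat 1 - A"
    have Bv: "B *v y = of_real \<mu> *s y - A *v y" for y
      by (simp add: B_def matrix_vector_mult_diff_rdistrib scaleR_matrix_mult_vec)
    have Bx: "cinner y (B *v x) = 0" if "y \<in> V" for y
    proof (rule null_vector_of_nonneg_form[OF _ V])
      show "cadjoint B = B"
        by (simp add: B_def cadjoint_diff cadjoint_scaleR herm)
      show "0 \<le> Re (cinner z (B *v z))" if "z \<in> V" for z
        using max[OF that]
        by (simp add: Bv cinner_diff_right cinner_scale_right cinner_self \<mu>_def flip: of_real_power)
      show "Re (cinner x (B *v x)) = 0"
        by (simp add: Bv cinner_diff_right cinner_scale_right xx \<mu>_def)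
    qed (use x that in auto)
    have Ax: "cinner y (A *v x) = 0" if "y \<in> V" "cinner y x = 0" for y
      using Bx[OF that(1)] that(2) by (simp add: Bv cinner_diff_right cinner_scale_right)
    define W where "W = {y \<in> V. cinner x y = 0}"
    have W: "vec.subspace W"
      using V by (auto simp: W_def vec.subspace_def cinner_add_right cinner_scale_right)
    have "x \<notin> W" using xx by (simp add: W_def)
    then have "W \<subset> V" using x unfolding W_def by blast
    then have "vec.span W \<subset> vec.span V"
      unfolding vec.span_eq_iff[THEN iffD2, OF V] vec.span_eq_iff[THEN iffD2, OF W] .
    then have "vec.dim W < vec.dim V" by (rule vec.dim_psubset)
    from less.hyps[OF this W] obtain d :: nat and w :: "nat \<Rightarrow> complex ^ 'n"
      where w: "orthonormal_on {1..d} w"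
      and span: "vec.span (w ` {1..d}) = W"
      and diag: "\<forall>j\<in>{1..d}. \<forall>k\<in>{1..d}. j \<noteq> k \<longrightarrow> cinner (w j) (A *v w k) = 0"
      by blast
    have wW: "w j \<in> V" "cinner x (w j) = 0" "cinner (w j) x = 0" if "j \<in> {1..d}" for j
    proof -
      have "w j \<in> W" unfolding span[symmetric] by (intro vec.span_base imageI that)
      then show "w j \<in> V" "cinner x (w j) = 0" by (auto simp: W_def)
      then show "cinner (w j) x = 0" by (metis cnj_cinner complex_cnj_zero)
    qed
    define w' where "w' = w(Suc d := x)"
    have w': "w' (Suc d) = x" "\<And>j. j \<in> {1..d} \<Longrightarrow> w' j = w j"
      by (auto simp: w'_def)
    have set: "{1..Suc d} = insert (Suc d) {1..d}" by auto
    have "orthonormal_on {1..Suc d} w'"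
      using w wW by (auto simp: orthonormal_on_def set w'_def xx)
    moreover have "vec.span (w' ` {1..Suc d}) = V"
    proof -
      have "vec.span (insert x (w ` {1..d})) = V"
      proof
        show "vec.span (insert x (w ` {1..d})) \<subseteq> V"
          using x wW V by (intro vec.span_minimal) auto
        show "V \<subseteq> vec.span (insert x (w ` {1..d}))"
        proof
          fix y assume y: "y \<in> V"
          have "y - cinner x y *s x \<in> W"
            using y x V xx
            by (auto simp: W_def cinner_diff_right cinner_scale_right
                intro: vec.subspace_diff vec.subspace_scale)
          then show "y \<in> vec.span (insert x (w ` {1..d}))"
            using span vec.span_breakdown_eq by blast
        qed
      qed
      moreover have "w' ` {1..Suc d} = insert x (w ` {1..d})"
        by (simp only: set image_insert w'(1) image_cong[OF refl w'(2)])
      ultimately show ?thesis by (simp only:)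
    qed
    moreover have "cinner (w' j) (A *v w' k) = 0"
      if jk: "j \<in> {1..Suc d}" "k \<in> {1..Suc d}" "j \<noteq> k" for j k
    proof -
      have "cinner (w j) (A *v x) = 0" "cinner x (A *v w j) = 0" if "j \<in> {1..d}" for j
      proof -
        show "cinner (w j) (A *v x) = 0"
          using Ax wW[OF that] by blast
        then show "cinner x (A *v w j) = 0"
          by (metis cnj_cinner complex_cnj_zero hermitian_cinner[OF herm])
      qed
      then show ?thesis
        using jk diag by (auto simp: set w'_def)
    qed
    ultimately show ?thesis
      by (intro exI[of _ "Suc d"] exI[of _ w']) (intro conjI ballI impI)
  qed
qed

lemma orthonormal_resolution:
  assumes J: "finite J" and w: "orthonormal_on J w" and span: "vec.span (w ` J) = UNIV"
  shows "(\<Sum>j\<in>J. ketbra (w j) (w j)) = mat 1"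
  using orthonormal_expansion[OF J w, symmetric] span
  by (simp add: matrix_eq sum_matrix_mult_vec ketbra_mult_vec)

text \<open>On the whole space a diagonalizing basis consists of eigenvectors; the eigenvalues are
  nonnegative, and their square roots are absorbed into the vectors.\<close>

lemma psd_sum_ketbra:
  fixes B :: "complex ^ 'n ^ 'n"
  assumes "psd B"
  shows "\<exists>d u. B = (\<Sum>j\<in>{1..d::nat}. ketbra (u j) (u j))"
proof -
  have herm: "cadjoint B = B" using assms by (rule psd_cadjoint)
  obtain d :: nat and w :: "nat \<Rightarrow> complex ^ 'n" where w: "orthonormal_on {1..d} w"
    and span: "vec.span (w ` {1..d}) = UNIV"
    and diag: "\<forall>j\<in>{1..d}. \<forall>k\<in>{1..d}. j \<noteq> k \<longrightarrow> cinner (w j) (B *v w k) = 0"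
    using diagonalizing_orthonormal_basis[OF vec.subspace_UNIV herm] by metis
  define \<beta> where "\<beta> = (\<lambda>j. Re (cinner (w j) (B *v w j)))"
  have \<beta>: "cinner (w j) (B *v w j) = of_real (\<beta> j)" for j
    unfolding \<beta>_def by (rule hermitian_quadratic_real[OF herm])
  have Bw: "B *v w k = of_real (\<beta> k) *s w k" if k: "k \<in> {1..d}" for k
  proof -
    have "B *v w k = (\<Sum>j\<in>{1..d}. cinner (w j) (B *v w k) *s w j)"
      by (rule orthonormal_expansion[OF _ w]) (simp_all only: span UNIV_I finite_atLeastAtMost)
    also have "\<dots> = (\<Sum>j\<in>{1..d}. if j = k then of_real (\<beta> k) *s w k else 0)"
      by (rule sum.cong) (use diag k in \<open>auto simp: \<beta>\<close>)
    finally show ?thesis using k by simp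
  qed
  have "B = B ** (\<Sum>j\<in>{1..d}. ketbra (w j) (w j))"
    using orthonormal_resolution[OF _ w span] by simp
  also have "\<dots> = (\<Sum>j\<in>{1..d}. \<beta> j *\<^sub>R ketbra (w j) (w j))"
    unfolding matrix_sum_ldistrib matrix_mult_ketbra
    by (rule sum.cong) (simp_all add: Bw ketbra_def vec_eq_iff
        scaleR_conv_of_real[where 'a = complex] mult.assoc)
  also have "\<dots> = (\<Sum>j\<in>{1..d}. ketbra (sqrt (\<beta> j) *\<^sub>R w j) (sqrt (\<beta> j) *\<^sub>R w j))"
    using psd_cinner_nonneg[OF assms] by (simp add: ketbra_scaleR \<beta>_def)
  finally show ?thesis by (intro exI)
qed

text \<open>With \<open>B\<close> a sum of \<open>ketbra (u j) (u j)\<close>, the trace is a sum of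
  the nonnegative numbers \<open>cinner (u j) (A *v u j)\<close>. If it vanishes, \<open>A\<close>
  kills every \<open>u j\<close>.\<close>

lemma trace_mult_psd:
  assumes "psd A" "psd B"
  shows trace_mult_psd_nonneg: "0 \<le> Re (trace (A ** B))"
    and trace_mult_psd_eq_0: "Re (trace (A ** B)) = 0 \<Longrightarrow> A ** B = 0"
proof -
  obtain d :: nat and u where B: "B = (\<Sum>j\<in>{1..d}. ketbra (u j) (u j))"
    using psd_sum_ketbra[OF assms(2)] by blast
  have tr: "Re (trace (A ** B)) = (\<Sum>j\<in>{1..d}. Re (cinner (u j) (A *v u j)))"
    by (simp add: B matrix_sum_ldistrib trace_sum matrix_mult_ketbra trace_ketbra)
  show "0 \<le> Re (trace (A ** B))"
    unfolding tr using assms(1) by (intro sum_nonneg) (simp add: psd_def)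
  assume "Re (trace (A ** B)) = 0"
  then have "\<forall>j\<in>{1..d}. Re (cinner (u j) (A *v u j)) = 0"
    unfolding tr using psd_cinner_nonneg[OF assms(1)] by (subst (asm) sum_nonneg_eq_0_iff) auto
  then have "A *v u j = 0" if "j \<in> {1..d}" for j
    using psd_null_vector[OF assms(1)] that by blast
  then show "A ** B = 0"
    by (simp add: B matrix_sum_ldistrib matrix_mult_ketbra)
      (simp add: ketbra_def vec_eq_iff)
qed

text \<open>Since \<open>D (B + C) + (B + C) D = 0\<close> for \<open>D = B - C\<close>, the trace of \<open>D (B + C) D\<close> vanishes.\<close>

lemma psd_sqrt_unique:
  fixes B C :: "complex ^ 'n ^ 'n"
  assumes B: "psd B" and C: "psd C" and sq: "B ** B = C ** C"
    and inj: "\<And>x. C *v x = 0 \<Longrightarrow> x = 0"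
  shows "B = C"
proof -
  define D where "D = B - C"
  define P where "P = B + C"
  have P: "psd P" using B C by (simp add: P_def psd_add)
  have D: "cadjoint D = D" using B C by (simp add: D_def cadjoint_diff psd_cadjoint)
  have anti: "D *v (P *v x) + P *v (D *v x) = 0" for x
  proof -
    have "B *v (B *v x) = C *v (C *v x)"
      using sq by (simp add: matrix_vector_mul_assoc)
    then show ?thesis
      by (simp add: D_def P_def matrix_vector_mult_add_rdistrib matrix_vector_mult_diff_rdistrib
          matrix_vector_right_distrib matrix_vector_mult_diff_distrib)
  qed
  have Pinj: "x = 0" if "P *v x = 0" for x
  proof -
    have "Re (cinner x (B *v x)) + Re (cinner x (C *v x)) = 0"
      using that by (metis P_def cinner_add_right cinner_zero_right matrix_vector_mult_add_rdistrib
          plus_complex.sel(1) zero_complex.sel(1))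
    then have "Re (cinner x (C *v x)) = 0"
      using psd_cinner_nonneg[OF B, of x] psd_cinner_nonneg[OF C, of x] by linarith
    then show "x = 0" using psd_null_vector[OF C] inj by blast
  qed
  obtain d :: nat and u where u: "P = (\<Sum>j\<in>{1..d}. ketbra (u j) (u j))"
    using psd_sum_ketbra[OF P] by blast
  have "P ** D + D ** P = 0"
    using anti by (simp add: matrix_eq matrix_vector_mult_add_rdistrib add.commute
        flip: matrix_vector_mul_assoc)
  then have "D ** (P ** D) + D ** (D ** P) = D ** 0"
    by (simp flip: matrix_add_ldistrib)
  also have "D ** 0 = 0"
    by (simp add: matrix_eq flip: matrix_vector_mul_assoc)
  finally have "trace (D ** (P ** D) + D ** (D ** P)) = trace (0 :: complex ^ 'n ^ 'n)"
    by simp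
  then have "trace (D ** (P ** D)) + trace (D ** (D ** P)) = 0"
    unfolding trace_add by (simp add: trace_0[unfolded mat_0])
  moreover have "trace (D ** (P ** D)) = trace (D ** (D ** P))"
    by (metis matrix_mul_assoc trace_mul_sym)
  ultimately have "trace (D ** (D ** P)) = 0"
    by simp
  \<comment> \<open>This trace is the sum of the squared norms of \<open>D *v u j\<close>, so
    \<open>D\<close> kills every \<open>u j\<close> and hence the range of \<open>P\<close>.
    Anticommutation then gives \<open>P *v (D *v x) = 0\<close>, and \<open>P\<close> is
    injective.\<close>
  moreover have "trace (D ** (D ** P)) = (\<Sum>j\<in>{1..d}. cinner (D *v u j) (D *v u j))"
    by (simp add: u matrix_sum_ldistrib trace_sum matrix_mult_ketbra trace_ketbra
        hermitian_cinner[OF D])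
  ultimately have "(\<Sum>j\<in>{1..d}. (norm (D *v u j))\<^sup>2) = 0"
    by (simp add: cinner_self flip: of_real_power of_real_sum)
  then have Du: "D *v u j = 0" if "j \<in> {1..d}" for j
    using that by (subst (asm) sum_nonneg_eq_0_iff) auto
  have "D *v (P *v x) = 0" for x
    by (simp add: u sum_matrix_mult_vec matrix_mult_vec_sum ketbra_mult_vec matrix_mult_vec_scale Du)
  then have "D *v x = 0" for x
    using anti[of x] by - (rule Pinj, simp)
  then show ?thesis
    by (simp add: D_def matrix_eq matrix_vector_mult_diff_rdistrib)
qed

lemma msqrt_eqI:
  assumes "psd C" and "\<And>x. C *v x = 0 \<Longrightarrow> x = 0"
  shows "msqrt (C ** C) = C"
  unfolding msqrt_def
  by (rule the_equality) (use assms(1) psd_sqrt_unique[OF _ assms(1) _ assms(2)] in blast)+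

text \<open>Because the \<open>W k\<close> sum to the identity, the weighted states sum to
  \<open>C ** C\<close>, whose square root is \<open>C\<close>; the inverse of \<open>C\<close> on
  both sides then strips \<open>C ** W k ** C\<close> down to \<open>W k\<close>.\<close>

lemma PGM_eqI:
  assumes C: "psd C" and inj: "\<And>x. C *v x = 0 \<Longrightarrow> x = 0"
    and W: "(\<Sum>k\<in>K. W k) = mat 1"
    and eq: "\<And>k. k \<in> K \<Longrightarrow> q k *\<^sub>R \<sigma> k = C ** W k ** C"
    and k: "k \<in> K"
  shows "PGM K q \<sigma> k = W k"
proof -
  define T where "T = matrix_inv C"
  have "invertible C"
    unfolding invertible_left_inverse matrix_left_invertible_ker using inj by blast
  then have "\<exists>T. C ** T = mat 1 \<and> T ** C = mat 1"
    by (simp add: invertible_def)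
  then have T: "T ** C = mat 1" "C ** T = mat 1"
    unfolding T_def matrix_inv_def by (rule someI2_ex, simp)+
  have "(\<Sum>k\<in>K. q k *\<^sub>R \<sigma> k) = C ** (\<Sum>k\<in>K. W k) ** C"
    by (simp add: eq matrix_sum_ldistrib matrix_sum_rdistrib)
  then have "msqrt (\<Sum>k\<in>K. q k *\<^sub>R \<sigma> k) = C"
    using msqrt_eqI[OF C inj] by (simp add: W)
  then have "PGM K q \<sigma> k = T ** (C ** W k ** C) ** T"
    by (simp add: PGM_def Let_def eq[OF k] T_def)
  also have "\<dots> = (T ** C) ** W k ** (C ** T)"
    by (simp only: matrix_mul_assoc)
  finally show ?thesis by (simp add: T)
qed

subsection \<open>Optimality conditions\<close>

lemma success_prob_eq_trace:
  "success_prob I p \<rho> M = (\<Sum>i\<in>I. Re (trace ((p i *\<^sub>R \<rho> i) ** M i)))"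
  by (simp add: success_prob_def scaleR_matrix_mult_left trace_scaleR)

text \<open>The adjoint reverses the product and conjugates the trace, so up to cyclic order the two
  traces are complex conjugates.\<close>

lemma trace_mult_hermitian_swap:
  assumes "cadjoint A = A" "cadjoint B = B" "cadjoint C = C"
  shows "Re (trace (A ** B ** C)) = Re (trace (A ** C ** B))"
proof -
  have "trace (A ** C ** B) = trace (C ** B ** A)"
    by (metis matrix_mul_assoc trace_mul_sym)
  also have "\<dots> = cnj (trace (A ** B ** C))"
    unfolding trace_cadjoint[symmetric] by (simp add: cadjoint_mult assms matrix_mul_assoc)
  finally show ?thesis by simp
qed

text \<open>The competitor to \<open>M\<close> compresses every element by \<open>1 - \<epsilon> |x\<rangle>\<langle>x|\<close> and gives the missing
  weight along \<open>x\<close> to the \<open>j\<close>-th outcome; the claim is the first-order term in \<open>\<epsilon>\<close>.\<close>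

lemma optimal_POVM_variation:
  fixes \<rho> M :: "'i \<Rightarrow> complex ^ 'n ^ 'n"
  assumes I: "finite I" and opt: "optimal_POVM I p \<rho> M" and j: "j \<in> I"
    and \<rho>: "\<And>i. i \<in> I \<Longrightarrow> cadjoint (\<rho> i) = \<rho> i"
  shows "Re (cinner x ((p j *\<^sub>R \<rho> j) *v x)) \<le> Re (cinner x ((\<Sum>i\<in>I. (p i *\<^sub>R \<rho> i) ** M i) *v x))"
proof (rule ccontr)
  define A where "A = (\<lambda>i. p i *\<^sub>R \<rho> i)"
  define P where "P = ketbra x x"
  define s where "s = (norm x)\<^sup>2"
  define Z where "Z = (\<Sum>i\<in>I. A i ** M i)"
  \<comment> \<open>\<open>c\<close> collects the second-order terms and \<open>\<delta>\<close> the
    first-order ones: the exact gain of the competitor is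
    \<open>\<epsilon> * (\<delta> + \<epsilon> * c)\<close>.\<close>
  define c where "c = (\<Sum>i\<in>I. Re (trace (A i ** P ** M i ** P))) - s * Re (trace (A j ** P))"
  define \<delta> where "\<delta> = 2 * Re (cinner x (A j *v x)) - 2 * Re (cinner x (Z *v x))"
  assume "\<not> ?thesis"
  then have \<delta>: "\<delta> > 0" by (simp add: \<delta>_def Z_def A_def)
  \<comment> \<open>The first bound keeps \<open>\<epsilon> * s \<le> 1\<close>, so that the weight
    given to outcome \<open>j\<close> is nonnegative; the second keeps the second-order term below
    \<open>\<delta>\<close>.\<close>
  define \<epsilon> where "\<epsilon> = min (1 / (s + 1)) (\<delta> / (2 * (\<bar>c\<bar> + 1)))"
  have s: "s \<ge> 0" by (simp add: s_def)
  have \<epsilon>: "\<epsilon> > 0" using \<delta> s by (simp add: \<epsilon>_def)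
  have "\<epsilon> * (s + 1) \<le> 1"
    using s by (simp add: \<epsilon>_def min_mult_distrib_right pos_le_divide_eq flip: pos_le_divide_eq)
  then have \<epsilon>s: "\<epsilon> * s \<le> 1" using \<epsilon> by (simp add: algebra_simps)
  have "\<epsilon> * \<bar>c\<bar> \<le> \<delta> / (2 * (\<bar>c\<bar> + 1)) * \<bar>c\<bar>"
    by (intro mult_right_mono) (simp_all add: \<epsilon>_def)
  also have "\<dots> < \<delta>"
    using \<delta> by (simp add: divide_simps)
  finally have \<epsilon>c: "\<epsilon> * \<bar>c\<bar> < \<delta>" .

  have POVM: "POVM I M" using opt by (simp add: optimal_POVM_def)
  have M: "psd (M i)" "cadjoint (M i) = M i" if "i \<in> I" for i
    using POVM that by (auto simp: POVM_def psd_def)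
  have A: "cadjoint (A i) = A i" if "i \<in> I" for i
    using \<rho>[OF that] by (simp add: A_def cadjoint_scaleR)
  have P: "cadjoint P = P" by (simp add: P_def cadjoint_ketbra)
  have PP: "P ** P = s *\<^sub>R P"
    by (simp add: P_def matrix_mult_ketbra ketbra_mult_vec cinner_self s_def)
      (simp add: ketbra_def vec_eq_iff scaleR_conv_of_real[where 'a = complex] mult.assoc)
  define E where "E = mat 1 - \<epsilon> *\<^sub>R P"
  have E: "cadjoint E = E" by (simp add: E_def cadjoint_diff cadjoint_scaleR P)
  have expand: "E ** X ** E = X - \<epsilon> *\<^sub>R (P ** X) - \<epsilon> *\<^sub>R (X ** P) + \<epsilon>\<^sup>2 *\<^sub>R (P ** X ** P)" for X
    by (simp add: E_def matrix_diff_ldistrib matrix_diff_rdistrib scaleR_matrix_mult_left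
        scaleR_matrix_mult_right power2_eq_square scaleR_diff_right)
  \<comment> \<open>Since \<open>P ** P = s *\<^sub>R P\<close>, the square of \<open>E\<close>
    falls short of the identity by exactly this multiple of \<open>P\<close>.\<close>
  define N where "N = (\<lambda>i. E ** M i ** E + (if i = j then (\<epsilon> * (2 - \<epsilon> * s)) *\<^sub>R P else 0))"
  have "POVM I N"
  proof -
    have "psd (N i)" if "i \<in> I" for i
    proof -
      have "psd (E ** M i ** E)" using psd_conjugate[OF M(1)[OF that], of E] by (simp add: E)
      moreover have "psd ((\<epsilon> * (2 - \<epsilon> * s)) *\<^sub>R P)"
        using \<epsilon> \<epsilon>s by (intro psd_scaleR) (auto simp: P_def psd_ketbra)
      ultimately show ?thesis by (auto simp: N_def intro: psd_add)
    qed
    moreover have "(\<Sum>i\<in>I. N i) = E ** (\<Sum>i\<in>I. M i) ** E + (\<epsilon> * (2 - \<epsilon> * s)) *\<^sub>R P"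
      using I j by (simp add: N_def sum.distrib matrix_sum_ldistrib matrix_sum_rdistrib)
    moreover have "\<dots> = mat 1"
      using POVM unfolding expand
      by (simp add: POVM_def PP power2_eq_square algebra_simps flip: scaleR_add_left)
    ultimately show ?thesis by (simp add: POVM_def)
  qed
  then have "success_prob I p \<rho> N \<le> success_prob I p \<rho> M"
    using opt by (simp add: optimal_POVM_def)
  moreover have "success_prob I p \<rho> N - success_prob I p \<rho> M = \<epsilon> * (\<delta> + \<epsilon> * c)"
  proof -
    have tr: "Re (trace (A i ** N i)) = Re (trace (A i ** M i)) - 2 * \<epsilon> * Re (trace (A i ** M i ** P))
        + \<epsilon>\<^sup>2 * Re (trace (A i ** P ** M i ** P))
        + (if i = j then \<epsilon> * (2 - \<epsilon> * s) * Re (trace (A i ** P)) else 0)" if i: "i \<in> I" for i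
    proof -
      \<comment> \<open>The swap makes the two first-order terms equal, whence the factor 2.\<close>
      have "Re (trace (A i ** P ** M i)) = Re (trace (A i ** M i ** P))"
        by (rule trace_mult_hermitian_swap) (simp_all add: A M P i)
      then show ?thesis
        by (simp add: N_def expand matrix_add_ldistrib matrix_diff_ldistrib scaleR_matrix_mult_right
            trace_add trace_diff trace_scaleR matrix_mul_assoc if_distrib[of trace] trace_0[unfolded mat_0])
    qed
    have 1: "(\<Sum>i\<in>I. Re (trace (A i ** M i ** P))) = Re (cinner x (Z *v x))"
      by (simp add: P_def matrix_mult_ketbra trace_ketbra Z_def sum_matrix_mult_vec cinner_sum_right)
    have 2: "Re (trace (A j ** P)) = Re (cinner x (A j *v x))"
      by (simp add: P_def matrix_mult_ketbra trace_ketbra)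
    have success: "success_prob I p \<rho> L = (\<Sum>i\<in>I. Re (trace (A i ** L i)))" for L
      by (simp add: success_prob_eq_trace A_def)
    have "success_prob I p \<rho> N - success_prob I p \<rho> M
        = - 2 * \<epsilon> * Re (cinner x (Z *v x)) + \<epsilon>\<^sup>2 * (\<Sum>i\<in>I. Re (trace (A i ** P ** M i ** P)))
          + \<epsilon> * (2 - \<epsilon> * s) * Re (trace (A j ** P))"
      using I j
      by (simp add: success tr sum.distrib sum_subtractf 1 flip: sum_distrib_left)
    then show ?thesis
      by (simp add: \<delta>_def c_def 2 power2_eq_square algebra_simps)
  qed
  moreover have "\<epsilon> * (\<delta> + \<epsilon> * c) > 0"
  proof -
    have "\<epsilon> * c \<ge> - (\<epsilon> * \<bar>c\<bar>)"
      using \<epsilon> by (metis abs_ge_minus_self abs_mult abs_of_pos minus_le_iff)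
    then show ?thesis using \<epsilon> \<epsilon>c by simp
  qed
  ultimately show False by simp
qed

text \<open>\<open>Z\<close> is a feasible point of the dual semidefinite program (minimize the
  trace subject to \<open>Z \<ge> A i\<close> for all \<open>i\<close>) whose value equals the
  success value of \<open>M\<close>.\<close>

definition optimality_certificate ::
  "'i set \<Rightarrow> ('i \<Rightarrow> complex ^ 'n ^ 'n) \<Rightarrow> ('i \<Rightarrow> complex ^ 'n ^ 'n) \<Rightarrow> complex ^ 'n ^ 'n \<Rightarrow> bool" where
  "optimality_certificate I A M Z \<longleftrightarrow>
    POVM I M \<and> (\<Sum>i\<in>I. A i ** M i) = Z \<and> (\<forall>i\<in>I. psd (Z - A i))"

text \<open>The duality gap between \<open>H\<close> and \<open>N\<close>. When
  \<open>H \<ge> A i\<close> for all \<open>i\<close>, its summands are nonnegative, so a zero gap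
  forces each of them to vanish.\<close>

lemma sum_trace_certificate_gap:
  fixes A N :: "'i \<Rightarrow> complex ^ 'n ^ 'n"
  assumes "POVM I N"
  shows "(\<Sum>i\<in>I. Re (trace ((H - A i) ** N i))) = Re (trace H) - (\<Sum>i\<in>I. Re (trace (A i ** N i)))"
proof -
  have "(\<Sum>i\<in>I. trace (H ** N i)) = trace (H ** (\<Sum>i\<in>I. N i))"
    by (simp add: matrix_sum_ldistrib trace_sum)
  also have "\<dots> = trace H"
    using assms by (simp add: POVM_def)
  finally have "(\<Sum>i\<in>I. Re (trace (H ** N i))) = Re (trace H)"
    by (metis Re_sum)
  then show ?thesis
    by (simp add: matrix_diff_rdistrib trace_diff sum_subtractf)
qed

text \<open>The variation only controls the Hermitian part \<open>H\<close> of \<open>Z\<close>. The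
  gap between \<open>H\<close> and \<open>M\<close> is zero, so
  \<open>A i ** M i = H ** M i\<close>, and summing over \<open>i\<close> gives
  \<open>Z = H\<close>.\<close>

lemma optimal_imp_certificate:
  fixes \<rho> M :: "'i \<Rightarrow> complex ^ 'n ^ 'n"
  assumes I: "finite I" and opt: "optimal_POVM I p \<rho> M"
    and \<rho>: "\<And>i. i \<in> I \<Longrightarrow> cadjoint (\<rho> i) = \<rho> i"
  shows "optimality_certificate I (\<lambda>i. p i *\<^sub>R \<rho> i) M (\<Sum>i\<in>I. (p i *\<^sub>R \<rho> i) ** M i)"
proof -
  define A where "A = (\<lambda>i. p i *\<^sub>R \<rho> i)"
  define Z where "Z = (\<Sum>i\<in>I. A i ** M i)"
  define H where "H = (1 / 2) *\<^sub>R (Z + cadjoint Z)"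
  have A: "cadjoint (A i) = A i" if "i \<in> I" for i
    using \<rho>[OF that] by (simp add: A_def cadjoint_scaleR)
  have POVM: "POVM I M" using opt by (simp add: optimal_POVM_def)
  have H_form: "Re (cinner x (H *v x)) = Re (cinner x (Z *v x))" for x
  proof -
    have "cinner x (cadjoint Z *v x) = cnj (cinner x (Z *v x))"
      by (simp add: cnj_cinner cinner_adjoint)
    then show ?thesis
      by (simp add: H_def scaleR_matrix_mult_vec matrix_vector_mult_add_rdistrib cinner_scale_right
          cinner_add_right)
  qed
  have gap: "psd (H - A i)" if i: "i \<in> I" for i
    unfolding psd_def
  proof (intro conjI allI)
    show "cadjoint (H - A i) = H - A i"
      by (simp add: H_def cadjoint_diff cadjoint_scaleR cadjoint_add A i add.commute)
    show "0 \<le> Re (cinner x ((H - A i) *v x))" for x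
      using optimal_POVM_variation[OF I opt i \<rho>, of x]
      by (simp add: matrix_vector_mult_diff_rdistrib cinner_diff_right H_form flip: A_def Z_def)
        (simp add: A_def Z_def)
  qed
  have "(\<Sum>i\<in>I. Re (trace ((H - A i) ** M i))) = 0"
    unfolding sum_trace_certificate_gap[OF POVM]
    by (simp add: H_def trace_scaleR trace_add trace_cadjoint Z_def trace_sum)
  then have "\<forall>i\<in>I. Re (trace ((H - A i) ** M i)) = 0"
    using gap POVM I
    by (subst (asm) sum_nonneg_eq_0_iff) (auto simp: POVM_def trace_mult_psd_nonneg)
  then have "(H - A i) ** M i = 0" if "i \<in> I" for i
    using gap POVM that by (auto simp: POVM_def intro: trace_mult_psd_eq_0)
  then have "A i ** M i = H ** M i" if "i \<in> I" for i
    using that by (simp add: matrix_diff_rdistrib)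
  then have "Z = H ** (\<Sum>i\<in>I. M i)"
    by (simp add: Z_def matrix_sum_ldistrib)
  then have "Z = H"
    using POVM by (simp add: POVM_def)
  then show ?thesis
    using POVM gap by (simp add: optimality_certificate_def flip: A_def Z_def) (simp add: A_def Z_def)
qed

text \<open>Weak duality: the trace of \<open>Z\<close> bounds every success probability and
  \<open>M\<close> attains it.\<close>

lemma certificate_imp_optimal:
  fixes \<rho> :: "'i \<Rightarrow> complex ^ 'n ^ 'n"
  assumes "optimality_certificate I (\<lambda>i. p i *\<^sub>R \<rho> i) M Z"
  shows "optimal_POVM I p \<rho> M"
  unfolding optimal_POVM_def
proof (intro conjI allI impI)
  show M: "POVM I M" using assms by (simp add: optimality_certificate_def)
  fix N :: "'i \<Rightarrow> complex ^ 'n ^ 'n" assume N: "POVM I N"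
  have "0 \<le> (\<Sum>i\<in>I. Re (trace ((Z - p i *\<^sub>R \<rho> i) ** N i)))"
    using assms N by (intro sum_nonneg trace_mult_psd_nonneg)
      (auto simp: optimality_certificate_def POVM_def)
  moreover have "Re (trace Z) = success_prob I p \<rho> M"
    using assms by (auto simp: optimality_certificate_def success_prob_eq_trace trace_sum)
  ultimately show "success_prob I p \<rho> N \<le> success_prob I p \<rho> M"
    unfolding sum_trace_certificate_gap[OF N] by (simp add: success_prob_eq_trace)
qed

text \<open>Every optimal \<open>N\<close> closes the duality gap with \<open>Z\<close>, not only
  the \<open>M\<close> that produced \<open>Z\<close>; uniqueness rests on this generality.\<close>

lemma certificate_complementary_slackness:
  fixes \<rho> :: "'i \<Rightarrow> complex ^ 'n ^ 'n"
  assumes I: "finite I" and cert: "optimality_certificate I (\<lambda>i. p i *\<^sub>R \<rho> i) M Z"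
    and N: "optimal_POVM I p \<rho> N" and i: "i \<in> I"
  shows "(p i *\<^sub>R \<rho> i) ** N i = Z ** N i"
proof -
  have M: "POVM I M" using cert by (simp add: optimality_certificate_def)
  have POVM: "POVM I N" using N by (simp add: optimal_POVM_def)
  have gap: "psd (Z - p i *\<^sub>R \<rho> i)" if "i \<in> I" for i
    using cert that by (simp add: optimality_certificate_def)
  have "success_prob I p \<rho> N = success_prob I p \<rho> M"
    using N certificate_imp_optimal[OF cert] by (auto simp: optimal_POVM_def intro: antisym)
  also have "\<dots> = Re (trace Z)"
    using cert by (auto simp: optimality_certificate_def success_prob_eq_trace trace_sum)
  finally have "(\<Sum>i\<in>I. Re (trace ((Z - p i *\<^sub>R \<rho> i) ** N i))) = 0"
    unfolding sum_trace_certificate_gap[OF POVM] by (simp add: success_prob_eq_trace)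
  then have "Re (trace ((Z - p i *\<^sub>R \<rho> i) ** N i)) = 0"
    using gap POVM I i
    by (subst (asm) sum_nonneg_eq_0_iff) (auto simp: POVM_def trace_mult_psd_nonneg)
  then have "(Z - p i *\<^sub>R \<rho> i) ** N i = 0"
    using gap[OF i] POVM i by (auto simp: POVM_def intro: trace_mult_psd_eq_0)
  then show ?thesis by (simp add: matrix_diff_rdistrib)
qed

text \<open>Linear independence of the ranges of the \<open>A i\<close>, phrased through preimages
  to match sums of the shape \<open>A i *v (M i *v x)\<close>.\<close>

definition independent_ranges :: "'i set \<Rightarrow> ('i \<Rightarrow> complex ^ 'n ^ 'n) \<Rightarrow> bool" where
  "independent_ranges I A \<longleftrightarrow>
    (\<forall>x. (\<Sum>i\<in>I. A i *v x i) = 0 \<longrightarrow> (\<forall>i\<in>I. A i *v x i = 0))"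

lemma independent_ranges_eq:
  assumes "independent_ranges I A" and "(\<Sum>i\<in>I. A i *v x i) = (\<Sum>i\<in>I. A i *v y i)" and "i \<in> I"
  shows "A i *v x i = A i *v y i"
proof -
  have "(\<Sum>i\<in>I. A i *v (x i - y i)) = 0"
    using assms(2) by (simp add: matrix_vector_mult_diff_distrib sum_subtractf)
  then have "A i *v (x i - y i) = 0"
    using assms(1)[unfolded independent_ranges_def, rule_format, of "\<lambda>i. x i - y i"] assms(3) by blast
  then show ?thesis by (simp add: matrix_vector_mult_diff_distrib)
qed

text \<open>\<open>Z x = \<Sum>\<^sub>i Z (N\<^sub>i x)\<close> is the decomposition of \<open>Z x\<close> along the independent ranges of
  the \<open>p\<^sub>i \<rho>\<^sub>i\<close>, whatever the optimal \<open>N\<close>.\<close>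

lemma certificate_imp_the_optimal:
  fixes \<rho> :: "'i \<Rightarrow> complex ^ 'n ^ 'n"
  assumes I: "finite I" and cert: "optimality_certificate I (\<lambda>i. p i *\<^sub>R \<rho> i) M Z"
    and indep: "independent_ranges I (\<lambda>i. p i *\<^sub>R \<rho> i)"
    and inj: "\<And>x. Z *v x = 0 \<Longrightarrow> x = 0"
  shows "the_optimal_POVM I p \<rho> M"
  unfolding the_optimal_POVM_def
proof (intro conjI allI impI ballI)
  show M: "optimal_POVM I p \<rho> M" by (rule certificate_imp_optimal[OF cert])
  fix N :: "'i \<Rightarrow> complex ^ 'n ^ 'n" and i assume N: "optimal_POVM I p \<rho> N" and i: "i \<in> I"
  have Z: "(\<Sum>i\<in>I. (p i *\<^sub>R \<rho> i) *v (L i *v x)) = Z *v x" if L: "optimal_POVM I p \<rho> L" for L x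
  proof -
    have "(\<Sum>i\<in>I. (p i *\<^sub>R \<rho> i) ** L i) = Z ** (\<Sum>i\<in>I. L i)"
      by (simp add: matrix_sum_ldistrib certificate_complementary_slackness[OF I cert L])
    then show ?thesis
      using L by (simp add: optimal_POVM_def POVM_def matrix_vector_mul_assoc flip: sum_matrix_mult_vec)
  qed
  have "N i *v x = M i *v x" for x
  proof -
    have "(p i *\<^sub>R \<rho> i) *v (N i *v x) = (p i *\<^sub>R \<rho> i) *v (M i *v x)"
      by (rule independent_ranges_eq[OF indep _ i]) (simp only: Z[OF N] Z[OF M])
    then have "Z *v (N i *v x - M i *v x) = 0"
      using certificate_complementary_slackness[OF I cert N i]
        certificate_complementary_slackness[OF I cert M i]
      by (simp add: matrix_vector_mult_diff_distrib matrix_vector_mul_assoc)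
    from inj[OF this] show ?thesis by simp
  qed
  then show "N i = M i" by (simp add: matrix_eq)
qed

text \<open>Lets optimality pass to the pretty good measurement, which is identified with the
  rank-one family only on the index set.\<close>

lemma the_optimal_POVM_cong:
  assumes "the_optimal_POVM I p \<rho> M" and eq: "\<And>i. i \<in> I \<Longrightarrow> M' i = M i"
  shows "the_optimal_POVM I p \<rho> M'"
proof -
  have "POVM I M' \<longleftrightarrow> POVM I M" "success_prob I p \<rho> M' = success_prob I p \<rho> M"
    using eq by (simp_all add: POVM_def success_prob_def)
  then have "optimal_POVM I p \<rho> M' \<longleftrightarrow> optimal_POVM I p \<rho> M"
    by (simp add: optimal_POVM_def)
  then show ?thesis
    using assms(1) eq unfolding the_optimal_POVM_def by metis
qed

lemma certificate_psd:
  assumes cert: "optimality_certificate I A M Z" and "\<And>i. i \<in> I \<Longrightarrow> psd (A i)" and "I \<noteq> {}"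
  shows "psd Z"
proof -
  obtain i where i: "i \<in> I" using assms(3) by blast
  then have "psd ((Z - A i) + A i)"
    using cert assms(2) by (intro psd_add) (auto simp: optimality_certificate_def)
  then show ?thesis by simp
qed

text \<open>\<open>Z *v (M k *v x)\<close> splits along the ranges of the \<open>A i\<close> in two
  ways: through \<open>M i *v (M k *v x)\<close> for all \<open>i\<close>, and by slackness through
  the single term at \<open>k\<close>. Independence and injectivity of \<open>Z\<close> identify the
  two.\<close>

lemma certificate_POVM_projective:
  assumes cert: "optimality_certificate I A M Z" and indep: "independent_ranges I A"
    and inj: "\<And>x. Z *v x = 0 \<Longrightarrow> x = 0"
    and slack: "\<And>i. i \<in> I \<Longrightarrow> A i ** M i = Z ** M i" and I: "finite I" "i \<in> I" "k \<in> I"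
  shows "M i ** M k = (if i = k then M k else 0)"
proof -
  have slack': "A i *v (M i *v x) = Z *v (M i *v x)" if "i \<in> I" for i x
    using slack[OF that] by (simp add: matrix_vector_mul_assoc)
  have "M i *v (M k *v x) = (if i = k then M k *v x else 0)" for x
  proof -
    define y where "y = (\<lambda>i. if i = k then M k *v x else 0)"
    have "(\<Sum>i\<in>I. A i *v (M i *v (M k *v x))) = Z *v ((\<Sum>i\<in>I. M i) *v (M k *v x))"
      by (simp add: slack' matrix_mult_vec_sum sum_matrix_mult_vec)
    also have "\<dots> = Z *v (M k *v x)"
      using cert by (simp add: optimality_certificate_def POVM_def)
    also have "\<dots> = (\<Sum>i\<in>I. A i *v y i)"
      using I by (simp add: y_def if_distrib[of "(*v) (A _)"] slack' cong: if_cong)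
    finally have "A i *v (M i *v (M k *v x)) = A i *v y i"
      by (rule independent_ranges_eq[OF indep _ I(2)])
    also have "\<dots> = Z *v y i"
      using I by (simp add: y_def slack')
    finally have "Z *v (M i *v (M k *v x) - y i) = 0"
      using I by (simp add: slack' matrix_vector_mult_diff_distrib)
    from inj[OF this] show ?thesis by (simp add: y_def)
  qed
  then show ?thesis by (auto simp: matrix_eq simp flip: matrix_vector_mul_assoc)
qed

section \<open>Supports and orthogonal projections\<close>

lemma subspace_supp: "vec.subspace (supp A)"
  by (auto simp: supp_def vec.subspace_def cinner_add_left cinner_scale_left)

lemma range_subset_supp: "cadjoint A = A \<Longrightarrow> A *v x \<in> supp A"
  by (simp add: supp_def flip: hermitian_cinner)

text \<open>\<open>x - M *v x\<close> lies in the kernel, while \<open>x\<close> and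
  \<open>M *v x\<close> lie in the support, so the difference is orthogonal to itself.\<close>

lemma projection_fixes_supp:
  assumes M: "cadjoint M = M" "M ** M = M" and x: "x \<in> supp M"
  shows "M *v x = x"
proof -
  have "M *v (x - M *v x) = 0"
    using M(2) by (simp add: matrix_vector_mult_diff_distrib matrix_vector_mul_assoc)
  then have "cinner x (x - M *v x) = 0" "cinner (M *v x) (x - M *v x) = 0"
    using x range_subset_supp[OF M(1), of x] by (auto simp: supp_def)
  then have "cinner (x - M *v x) (x - M *v x) = 0"
    by (simp add: cinner_diff_left)
  then show ?thesis by simp
qed

text \<open>Expand \<open>M *v x\<close> in the basis; since \<open>M\<close> fixes each
  \<open>w j\<close>, its coefficients are those of \<open>x\<close>.\<close>

lemma projection_eq_sum_ketbra:
  assumes M: "cadjoint M = M" "M ** M = M"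
    and J: "finite J" and w: "orthonormal_on J w" and span: "vec.span (w ` J) = supp M"
  shows "M = (\<Sum>j\<in>J. ketbra (w j) (w j))"
proof -
  have "M *v w j = w j" if "j \<in> J" for j
    using that span by (intro projection_fixes_supp[OF M]) (auto intro: vec.span_base)
  then have "cinner (w j) (M *v x) = cinner (w j) x" if "j \<in> J" for j x
    using that by (simp add: hermitian_cinner[OF M(1)])
  moreover have "M *v x = (\<Sum>j\<in>J. cinner (w j) (M *v x) *s w j)" for x
    using range_subset_supp[OF M(1)] by (intro orthonormal_expansion[OF J w]) (simp add: span)
  ultimately have "M *v x = (\<Sum>j\<in>J. cinner (w j) x *s w j)" for x
    by simp
  then show ?thesis
    by (simp add: matrix_eq sum_matrix_mult_vec ketbra_mult_vec)
qed

text \<open>The vectors \<open>A w\<^sub>j\<close> are independent and as many as the \<open>\<psi>\<^sub>j\<close>, hence they span the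
  range of \<open>A\<close>; the coefficients are then read off by pairing with the \<open>w\<^sub>j\<close>.\<close>

lemma sum_ketbra_diagonalizing_family:
  fixes A :: "complex ^ 'n ^ 'n"
  assumes J: "finite J" and A: "A = (\<Sum>j\<in>J. ketbra (\<psi> j) (\<psi> j))"
    and diag: "\<And>j k. j \<in> J \<Longrightarrow> k \<in> J \<Longrightarrow> cinner (w j) (A *v w k) = (if j = k then of_real (e j) else 0)"
    and e: "\<And>j. j \<in> J \<Longrightarrow> e j \<noteq> 0"
  shows "A = (\<Sum>j\<in>J. (1 / e j) *\<^sub>R ketbra (A *v w j) (A *v w j))"
proof -
  define u where "u = (\<lambda>j. A *v w j)"
  have herm: "cadjoint A = A" by (simp add: A cadjoint_sum cadjoint_ketbra)
  have pair: "cinner (w k) (\<Sum>j\<in>J. c j *s u j) = c k * of_real (e k)" if k: "k \<in> J" for c k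
  proof -
    have "cinner (w k) (\<Sum>j\<in>J. c j *s u j) = (\<Sum>j\<in>J. if k = j then c k * of_real (e k) else 0)"
      unfolding cinner_sum_right
      by (rule sum.cong) (use diag k in \<open>auto simp: cinner_scale_right u_def\<close>)
    then show ?thesis using J k by simp
  qed
  have indep: "independent_family J u"
  proof (rule independent_familyI[OF J], rule ballI)
    fix c k assume "(\<Sum>j\<in>J. c j *s u j) = 0" and k: "k \<in> J"
    then have "c k * of_real (e k) = 0"
      using pair[OF k, of c] by simp
    then show "c k = 0" using e[OF k] by simp
  qed
  then have inj: "inj_on u J" by (simp add: independent_family_def)
  have range: "A *v x \<in> vec.span (\<psi> ` J)" for x
    unfolding A sum_matrix_mult_vec ketbra_mult_vec
    by (intro vec.span_sum vec.span_scale vec.span_base imageI)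
  have "vec.span (\<psi> ` J) \<subseteq> vec.span (u ` J)"
  proof (rule vec.card_ge_dim_independent)
    show "u ` J \<subseteq> vec.span (\<psi> ` J)" using range by (auto simp: u_def)
    show "vec.independent (u ` J)" using indep by (simp add: independent_family_def)
    have "vec.dim (vec.span (\<psi> ` J)) \<le> card (\<psi> ` J)"
      using J by (intro vec.dim_le_card) auto
    also have "\<dots> \<le> card (u ` J)"
      using J by (simp add: card_image inj card_image_le)
    finally show "vec.dim (vec.span (\<psi> ` J)) \<le> card (u ` J)" .
  qed
  then have span: "A *v x \<in> vec.span (u ` J)" for x
    using range by blast
  have ex: "\<exists>c. A *v x = (\<Sum>j\<in>J. c j *s u j)" for x
  proof -
    obtain f where "A *v x = (\<Sum>v\<in>u ` J. f v *s v)"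
      using span[of x] J by (auto simp: vec.span_finite)
    then have "A *v x = (\<Sum>j\<in>J. f (u j) *s u j)"
      by (simp add: sum.reindex[OF inj])
    then show ?thesis by (rule exI[of _ "\<lambda>j. f (u j)"])
  qed
  have "A *v x = (\<Sum>j\<in>J. (1 / e j) *\<^sub>R ketbra (u j) (u j)) *v x" for x
  proof -
    obtain c where c: "A *v x = (\<Sum>j\<in>J. c j *s u j)" using ex by blast
    have "c j = of_real (1 / e j) * cinner (u j) x" if j: "j \<in> J" for j
    proof -
      have "cinner (u j) x = cinner (w j) (A *v x)"
        by (simp add: u_def hermitian_cinner[OF herm])
      also have "\<dots> = c j * of_real (e j)"
        unfolding c by (rule pair[OF j])
      finally show ?thesis using e[OF j] by simp
    qed
    then show ?thesis
      unfolding c sum_matrix_mult_vec scaleR_matrix_mult_vec ketbra_mult_vec vector_smult_assoc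
      by (intro sum.cong refl arg_cong2[where f = "(*s)"])
  qed
  then show ?thesis unfolding u_def matrix_eq by blast
qed

section \<open>Ensembles of the class \<open>in_E\<close>\<close>

lemma in_E_psd:
  assumes "in_E m r p \<rho>" and "i \<in> {1..m}"
  shows "psd (\<rho> i)" and "psd (p i *\<^sub>R \<rho> i)"
  using assms by (auto simp: in_E_def ensemble_def density_operator_def intro!: psd_scaleR less_imp_le)

lemma in_E_independent_ranges:
  assumes E: "in_E m r p \<rho>"
  shows "independent_ranges {1..m} (\<lambda>i. p i *\<^sub>R \<rho> i)"
proof -
  have supp: "(p i *\<^sub>R \<rho> i) *v x \<in> supp (\<rho> i)" if "i \<in> {1..m}" for i x
    using range_subset_supp[OF psd_cadjoint[OF in_E_psd(1)[OF E that]]]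
    by (simp add: scaleR_matrix_mult_vec vec.subspace_scale subspace_supp)
  have "independent_subspaces {1..m} (\<lambda>i. supp (\<rho> i))"
    using E by (simp add: in_E_def)
  then show ?thesis
    unfolding independent_subspaces_def independent_ranges_def using supp
    by (intro allI impI) (drule spec, erule mp, simp)
qed

text \<open>From \<open>Z \<ge> p i *\<^sub>R \<rho> i \<ge> 0\<close>, a null vector of
  \<open>Z\<close> is killed by every \<open>\<rho> i\<close>, hence orthogonal to all supports, and
  these span the space.\<close>

lemma in_E_certificate_injective:
  assumes E: "in_E m r p \<rho>" and cert: "optimality_certificate {1..m} (\<lambda>i. p i *\<^sub>R \<rho> i) M Z"
    and Z: "Z *v x = 0"
  shows "x = 0"
proof -
  have "\<rho> i *v x = 0" if i: "i \<in> {1..m}" for i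
  proof -
    have "psd (Z - p i *\<^sub>R \<rho> i)"
      using cert i by (simp add: optimality_certificate_def)
    from psd_cinner_nonneg[OF this, of x] have "Re (cinner x ((p i *\<^sub>R \<rho> i) *v x)) \<le> 0"
      unfolding matrix_vector_mult_diff_rdistrib Z cinner_diff_right by simp
    then have "(p i *\<^sub>R \<rho> i) *v x = 0"
      using psd_cinner_nonneg[OF in_E_psd(2)[OF E i], of x]
      by (intro psd_null_vector in_E_psd(2)[OF E i]) simp
    moreover have "p i \<noteq> 0" using E i by (force simp: in_E_def ensemble_def)
    ultimately show ?thesis by (simp add: scaleR_matrix_mult_vec)
  qed
  then have "(\<Union>i\<in>{1..m}. supp (\<rho> i)) \<subseteq> {y. cinner y x = 0}"
    by (auto simp: supp_def)
  moreover have "vec.subspace {y. cinner y x = 0}"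
    by (auto simp: vec.subspace_def cinner_add_left cinner_scale_left)
  ultimately have "vec.span (\<Union>i\<in>{1..m}. supp (\<rho> i)) \<subseteq> {y. cinner y x = 0}"
    by (rule vec.span_minimal)
  moreover have "vec.span (\<Union>i\<in>{1..m}. supp (\<rho> i)) = UNIV"
    using E by (simp add: in_E_def)
  ultimately have "cinner x x = 0" by blast
  then show ?thesis by simp
qed

text \<open>Applied to two orthonormal bases of one support, this shows that the left side does not
  depend on the basis.\<close>

lemma sum_ketbra_mult:
  "(\<Sum>j\<in>J. ketbra (A *v w j) (A *v w j))
    = A ** (\<Sum>j\<in>J. ketbra (w j) (w j)) ** cadjoint A"
  by (simp add: matrix_sum_ldistrib matrix_sum_rdistrib matrix_mult_ketbra ketbra_matrix_mult)

subsection \<open>The refined ensemble\<close>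

theorem mainTheorem9:
  fixes m :: nat and r :: "nat \<Rightarrow> nat"
    and p q :: "nat \<Rightarrow> real"
    and \<rho> \<sigma> M :: "nat \<Rightarrow> complex ^ 'n ^ 'n"
  assumes r_ge_1: "\<And>i. i \<in> {1..m} \<Longrightarrow> 1 \<le> r i"
    and r_decreasing: "\<And>i j. i \<in> {1..m} \<Longrightarrow> j \<in> {1..m} \<Longrightarrow> i \<le> j \<Longrightarrow> r j \<le> r i"
    and r_sum: "(\<Sum>i\<in>{1..m}. r i) = CARD('n)"
    and P_in_E: "in_E m r p \<rho>"
    and M_optimal: "optimal_POVM {1..m} p \<rho> M"
    and Q_eq_\<R>P: "\<R>_rel m r p \<rho> q \<sigma>"
  shows "let K = (SIGMA i:{1..m}. {1..r i}) in
    \<exists>(\<psi> :: nat \<times> nat \<Rightarrow> complex ^ 'n) (lam :: nat \<times> nat \<Rightarrow> real) (lam' :: nat \<times> nat \<Rightarrow> real).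
    independent_family K \<psi> \<and>
    (\<forall>k\<in>K. norm (\<psi> k) = 1 \<and> 0 < lam k \<and> 0 < lam' k) \<and>
    (\<Sum>k\<in>K. lam k) = 1 \<and> (\<Sum>k\<in>K. lam' k) = 1 \<and>
    (\<forall>i\<in>{1..m}. p i *\<^sub>R \<rho> i = (\<Sum>j\<in>{1..r i}. lam (i, j) *\<^sub>R ketbra (\<psi> (i, j)) (\<psi> (i, j)))) \<and>
    (\<exists>w :: nat \<times> nat \<Rightarrow> complex ^ 'n.
       the_optimal_POVM K lam (\<lambda>k. ketbra (\<psi> k) (\<psi> k)) (\<lambda>k. ketbra (w k) (w k)) \<and>
       (\<forall>i\<in>{1..m}. M i = (\<Sum>j\<in>{1..r i}. ketbra (w (i, j)) (w (i, j))))) \<and>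
    (\<forall>i\<in>{1..m}. q i *\<^sub>R \<sigma> i = (\<Sum>j\<in>{1..r i}. lam' (i, j) *\<^sub>R ketbra (\<psi> (i, j)) (\<psi> (i, j)))) \<and>
    the_optimal_POVM K lam (\<lambda>k. ketbra (\<psi> k) (\<psi> k)) (PGM K lam' (\<lambda>k. ketbra (\<psi> k) (\<psi> k)))"
proof -
  \<comment> \<open>Keeps the lower ends of the index intervals in the form
    \<open>1\<close>.\<close>
  note [simp del] = One_nat_def
  let ?I = "{1..m}"
  define K where "K = (SIGMA i:?I. {1..r i})"
  define A where "A = (\<lambda>i. p i *\<^sub>R \<rho> i)"
  define Z where "Z = (\<Sum>i\<in>?I. A i ** M i)"
  have finK: "finite K" by (simp add: K_def)
  have sumKM: "(\<Sum>k\<in>K. f k) = (\<Sum>i\<in>?I. \<Sum>j\<in>{1..r i}. f (i, j))"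
    for f :: "nat \<times> nat \<Rightarrow> complex ^ 'n ^ 'n"
    by (simp add: K_def sum.Sigma)
  have sumKR: "(\<Sum>k\<in>K. f k) = (\<Sum>i\<in>?I. \<Sum>j\<in>{1..r i}. f (i, j))"
    for f :: "nat \<times> nat \<Rightarrow> real"
    by (simp add: K_def sum.Sigma)

  \<comment> \<open>Certificate, uniqueness and projectivity for the given ensemble\<close>
  have psdA: "psd (A i)" if "i \<in> ?I" for i
    using in_E_psd(2)[OF P_in_E that] by (simp add: A_def)
  have hermA: "cadjoint (A i) = A i" if "i \<in> ?I" for i
    using psdA[OF that] by (rule psd_cadjoint)
  have sump: "sum p ?I = 1" and tr\<rho>: "\<And>i. i \<in> ?I \<Longrightarrow> trace (\<rho> i) = 1"
    using P_in_E by (auto simp: in_E_def ensemble_def density_operator_def)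
  have I: "?I \<noteq> {}" using sump by (metis sum.empty zero_neq_one)
  have cert: "optimality_certificate ?I A M Z"
    unfolding A_def Z_def
    by (rule optimal_imp_certificate[OF _ M_optimal])
      (auto intro!: psd_cadjoint in_E_psd(1)[OF P_in_E])
  have inj: "x = 0" if "Z *v x = 0" for x
    using in_E_certificate_injective[OF P_in_E cert[unfolded A_def] that] .
  have psdZ: "psd Z" using certificate_psd[OF cert psdA I] .
  note hermZ = psd_cadjoint[OF psdZ]
  have indep: "independent_ranges ?I A"
    unfolding A_def by (rule in_E_independent_ranges[OF P_in_E])
  have unique: "the_optimal_POVM ?I p \<rho> M"
    by (rule certificate_imp_the_optimal[OF _ cert[unfolded A_def] indep[unfolded A_def] inj]) simp_all
  have slack: "A i ** M i = Z ** M i" if "i \<in> ?I" for i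
    using certificate_complementary_slackness[OF _ cert[unfolded A_def] M_optimal that]
    by (simp add: A_def)
  have POVM: "\<And>i. i \<in> ?I \<Longrightarrow> psd (M i)" "(\<Sum>i\<in>?I. M i) = mat 1"
    using M_optimal by (auto simp: optimal_POVM_def POVM_def)
  have hermM: "cadjoint (M i) = M i" if "i \<in> ?I" for i
    using POVM(1)[OF that] by (rule psd_cadjoint)
  have proj: "M i ** M k = (if i = k then M k else 0)" if "i \<in> ?I" "k \<in> ?I" for i k
    by (rule certificate_POVM_projective[OF cert indep inj slack _ that]) simp_all

  \<comment> \<open>The data of \<open>\<R>_rel\<close> and the adapted orthonormal basis\<close>
  obtain M' \<psi>\<^sub>0 v where M': "optimal_POVM ?I p \<rho> M'"
    and \<psi>\<^sub>0: "\<And>i. i \<in> ?I \<Longrightarrow> A i = (\<Sum>j\<in>{1..r i}. ketbra (\<psi>\<^sub>0 i j) (\<psi>\<^sub>0 i j))"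
    and v': "\<And>i. i \<in> ?I \<Longrightarrow> onb_of (r i) (v i) (supp (M' i))"
    and q: "\<And>i. i \<in> ?I \<Longrightarrow>
      (let X = (\<lambda>i j k. cinner (\<psi>\<^sub>0 i j) (v i k));
           chi = (\<lambda>i j. \<Sum>k\<in>{1..r i}. X i k j *s \<psi>\<^sub>0 i k);
           N = (\<Sum>l\<in>?I. \<Sum>k\<in>{1..r l}. Re (cinner (chi l k) (chi l k)))
       in q i *\<^sub>R \<sigma> i = (1 / N) *\<^sub>R (\<Sum>j\<in>{1..r i}. ketbra (chi i j) (chi i j)))"
    using Q_eq_\<R>P unfolding \<R>_rel_def Let_def A_def by blast
  have v: "orthonormal_on {1..r i} (v i)" "vec.span (v i ` {1..r i}) = supp (M i)" if "i \<in> ?I" for i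
  proof -
    \<comment> \<open>\<open>\<R>_rel\<close> brings its own optimal POVM; uniqueness identifies it
      with \<open>M\<close>.\<close>
    have "M' i = M i"
      using unique M' that by (simp add: the_optimal_POVM_def)
    then show "orthonormal_on {1..r i} (v i)" "vec.span (v i ` {1..r i}) = supp (M i)"
      using v'[OF that] by (auto simp: onb_of_def orthonormal_on_def)
  qed
  have "\<exists>w. orthonormal_on {1..r i} w \<and> vec.span (w ` {1..r i}) = supp (M i) \<and>
    (\<forall>j\<in>{1..r i}. \<forall>k\<in>{1..r i}. j \<noteq> k \<longrightarrow> cinner (w j) (Z *v w k) = 0)" if i: "i \<in> ?I" for i
  proof -
    obtain d :: nat and w :: "nat \<Rightarrow> complex ^ 'n" where w: "orthonormal_on {1..d} w"
      "vec.span (w ` {1..d}) = supp (M i)"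
      "\<forall>j\<in>{1..d}. \<forall>k\<in>{1..d}. j \<noteq> k \<longrightarrow> cinner (w j) (Z *v w k) = 0"
      using diagonalizing_orthonormal_basis[OF subspace_supp hermZ] by blast
    \<comment> \<open>The basis \<open>v i\<close> of the same support already has
      \<open>r i\<close> elements.\<close>
    have "d = r i"
      using orthonormal_on_dim[OF _ w(1)] orthonormal_on_dim[OF _ v(1)[OF i]] w(2) v(2)[OF i]
      by (metis card_atLeastAtMost diff_Suc_1 finite_atLeastAtMost)
    with w show ?thesis by blast
  qed
  then obtain w where w: "\<And>i. i \<in> ?I \<Longrightarrow> orthonormal_on {1..r i} (w i)"
    "\<And>i. i \<in> ?I \<Longrightarrow> vec.span (w i ` {1..r i}) = supp (M i)"
    and diag: "\<And>i j k. i \<in> ?I \<Longrightarrow> j \<in> {1..r i} \<Longrightarrow> k \<in> {1..r i} \<Longrightarrow> j \<noteq> k \<Longrightarrow>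
      cinner (w i j) (Z *v w i k) = 0"
    by metis
  define W where "W = (\<lambda>(i, j). w i j)"
  define u where "u = (\<lambda>k. Z *v W k)"
  define e where "e = (\<lambda>k. Re (cinner (W k) (u k)))"
  have Mw: "M i *v w i j = w i j" if "i \<in> ?I" "j \<in> {1..r i}" for i j
  proof (rule projection_fixes_supp)
    show "w i j \<in> supp (M i)"
      using that by (metis imageI vec.span_base w(2))
  qed (use that proj hermM in auto)
  have MW: "M i = (\<Sum>j\<in>{1..r i}. ketbra (w i j) (w i j))" if "i \<in> ?I" for i
    using that proj hermM w by (intro projection_eq_sum_ketbra) auto
  have Mv: "M i = (\<Sum>j\<in>{1..r i}. ketbra (v i j) (v i j))" if "i \<in> ?I" for i
    using that proj hermM v by (intro projection_eq_sum_ketbra) auto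
  \<comment> \<open>As \<open>M i\<close> fixes \<open>w i j\<close>, slackness says that
    \<open>A i\<close> and \<open>Z\<close> agree on it.\<close>
  have Aw: "A i *v w i j = u (i, j)" if "i \<in> ?I" "j \<in> {1..r i}" for i j
    using slack[OF that(1)] Mw[OF that]
    by (metis (no_types, lifting) W_def case_prod_conv matrix_vector_mul_assoc u_def)
  have res: "(\<Sum>k\<in>K. ketbra (W k) (W k)) = mat 1"
  proof -
    have "(\<Sum>k\<in>K. ketbra (W k) (W k)) = (\<Sum>i\<in>?I. M i)"
      unfolding sumKM by (intro sum.cong refl) (simp add: W_def MW)
    then show ?thesis by (simp add: POVM(2))
  qed
  \<comment> \<open>Across blocks, orthogonality comes from \<open>M i ** M i' = 0\<close>.\<close>
  have ortho: "orthonormal_on K W"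
  proof -
    have "cinner (w i j) (w i' j') = 0" if "i \<in> ?I" "i' \<in> ?I" "i \<noteq> i'" "j \<in> {1..r i}" "j' \<in> {1..r i'}"
      for i i' j j'
    proof -
      have "cinner (w i j) (w i' j') = cinner (M i *v w i j) (M i' *v w i' j')"
        using that by (simp add: Mw)
      also have "\<dots> = cinner (w i j) ((M i ** M i') *v w i' j')"
        using that by (simp add: hermM flip: hermitian_cinner matrix_vector_mul_assoc)
      finally show ?thesis using that by (simp add: proj)
    qed
    moreover have "cinner (w i j) (w i j') = (if j = j' then 1 else 0)"
      if "i \<in> ?I" "j \<in> {1..r i}" "j' \<in> {1..r i}" for i j j'
      using w(1)[OF that(1)] that(2,3) unfolding orthonormal_on_def by blast
    ultimately have "cinner (w i j) (w i' j') = (if (i, j) = (i', j') then 1 else 0)"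
      if "i \<in> ?I" "i' \<in> ?I" "j \<in> {1..r i}" "j' \<in> {1..r i'}" for i i' j j'
      using that by (cases "i = i'") simp_all
    then show ?thesis
      unfolding orthonormal_on_def K_def W_def by (intro ballI) (clarsimp simp del: atLeastAtMost_iff)
  qed
  have W: "W k \<noteq> 0" if "k \<in> K" for k
    using ortho that by (force simp: orthonormal_on_def)
  have u_nz: "u k \<noteq> 0" if "k \<in> K" for k
    using inj[of "W k"] W[OF that] by (auto simp: u_def)
  have e_pos: "e k > 0" if "k \<in> K" for k
    using psd_null_vector[OF psdZ, of "W k"] psd_cinner_nonneg[OF psdZ, of "W k"] u_nz[OF that]
    by (force simp: e_def u_def order_less_le)
  have e: "cinner (W k) (u k) = of_real (e k)" for k
    unfolding e_def u_def by (rule hermitian_quadratic_real[OF hermZ])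
  have e': "cinner (u k) (W k) = of_real (e k)" for k
    using e[of k] by (simp add: u_def hermitian_cinner[OF hermZ])
  have u_indep: "\<forall>k\<in>K. c k = 0" if "(\<Sum>k\<in>K. c k *s u k) = 0" for c
  proof -
    have "Z *v (\<Sum>k\<in>K. c k *s W k) = 0"
      using that by (simp add: matrix_mult_vec_sum matrix_mult_vec_scale u_def)
    from inj[OF this] show ?thesis
      using cinner_orthonormal_combination[OF finK ortho, of _ c] by simp
  qed
  \<comment> \<open>On \<open>w i j\<close> the forms of \<open>A i\<close> and \<open>Z\<close>
    coincide, so the basis diagonalizes \<open>A i\<close> too; \<open>\<psi>\<^sub>0\<close>
    supplies a decomposition of \<open>A i\<close> into the required \<open>r i\<close>
    terms.\<close>
  have A_u: "A i = (\<Sum>j\<in>{1..r i}. (1 / e (i, j)) *\<^sub>R ketbra (u (i, j)) (u (i, j)))" if i: "i \<in> ?I" for i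
  proof -
    have "A i = (\<Sum>j\<in>{1..r i}. (1 / e (i, j)) *\<^sub>R ketbra (A i *v w i j) (A i *v w i j))"
    proof (rule sum_ketbra_diagonalizing_family[OF _ \<psi>\<^sub>0[OF i]])
      show "cinner (w i j) (A i *v w i k) = (if j = k then of_real (e (i, j)) else 0)"
        if "j \<in> {1..r i}" "k \<in> {1..r i}" for j k
        using that i diag[of i j k] e[of "(i, j)"] by (cases "j = k") (simp_all add: Aw u_def W_def)
      show "e (i, j) \<noteq> 0" if "j \<in> {1..r i}" for j
        using e_pos[of "(i, j)"] that i by (auto simp: K_def)
    qed simp
    then show ?thesis using i by (simp add: Aw)
  qed

  define N where "N = (\<Sum>k\<in>K. (norm (u k))\<^sup>2)"
  have AMA: "A i ** M i ** A i = (\<Sum>j\<in>{1..r i}. ketbra (u (i, j)) (u (i, j)))" if i: "i \<in> ?I" for i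
    using sum_ketbra_mult[of "A i" "w i" "{1..r i}", folded MW[OF i]] i by (simp add: hermA Aw)
  have q_eq: "q i *\<^sub>R \<sigma> i = (1 / N) *\<^sub>R (\<Sum>j\<in>{1..r i}. ketbra (u (i, j)) (u (i, j)))" if i: "i \<in> ?I" for i
  proof -
    define chi where "chi = (\<lambda>i j. \<Sum>k\<in>{1..r i}. cinner (\<psi>\<^sub>0 i k) (v i j) *s \<psi>\<^sub>0 i k)"
    \<comment> \<open>With \<open>A i\<close> written through \<open>\<psi>\<^sub>0\<close>, the
      coefficients of \<open>chi i j\<close> are exactly those of
      \<open>A i *v v i j\<close>.\<close>
    have chi: "chi i j = A i *v v i j" if "i \<in> ?I" for i j
      using \<psi>\<^sub>0[OF that] by (simp add: chi_def sum_matrix_mult_vec ketbra_mult_vec)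
    have AvA: "(\<Sum>j\<in>{1..r i}. ketbra (A i *v v i j) (A i *v v i j)) = A i ** M i ** A i" if "i \<in> ?I" for i
      using sum_ketbra_mult[of "A i" "v i" "{1..r i}", folded Mv[OF that]] that by (simp add: hermA)
    \<comment> \<open>Both sums are the trace of \<open>A l ** M l ** A l\<close>, so the
      normalization in \<open>\<R>_rel\<close> is \<open>N\<close>.\<close>
    have "(\<Sum>k\<in>{1..r l}. Re (cinner (A l *v v l k) (A l *v v l k))) = (\<Sum>k\<in>{1..r l}. (norm (u (l, k)))\<^sup>2)"
      if l: "l \<in> ?I" for l
    proof -
      have "(\<Sum>k\<in>{1..r l}. Re (cinner (A l *v v l k) (A l *v v l k))) = Re (trace (A l ** M l ** A l))"
        unfolding AvA[OF l, symmetric] by (simp add: trace_sum trace_ketbra)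
      also have "\<dots> = (\<Sum>k\<in>{1..r l}. (norm (u (l, k)))\<^sup>2)"
        unfolding AMA[OF l] by (simp add: trace_sum trace_ketbra cinner_self flip: of_real_power)
      finally show ?thesis .
    qed
    then have "(\<Sum>l\<in>?I. \<Sum>k\<in>{1..r l}. Re (cinner (A l *v v l k) (A l *v v l k))) = N"
      by (simp add: N_def sumKR)
    moreover have "(\<Sum>l\<in>?I. \<Sum>k\<in>{1..r l}. Re (cinner (chi l k) (chi l k)))
        = (\<Sum>l\<in>?I. \<Sum>k\<in>{1..r l}. Re (cinner (A l *v v l k) (A l *v v l k)))"
      by (intro sum.cong refl) (simp only: chi)
    moreover have "(\<Sum>j\<in>{1..r i}. ketbra (chi i j) (chi i j))
        = (\<Sum>j\<in>{1..r i}. ketbra (u (i, j)) (u (i, j)))"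
      using AvA[OF i] AMA[OF i] by (simp only: chi[OF i])
    ultimately show ?thesis
      using q[OF i] unfolding Let_def chi_def by (simp only:)
  qed

  \<comment> \<open>Normalized vectors and the two systems of weights\<close>
  define \<psi> where "\<psi> = (\<lambda>k. (1 / norm (u k)) *\<^sub>R u k)"
  \<comment> \<open>The squared norm undoes the normalization of \<open>\<psi> k\<close>, leaving
    the weight \<open>1 / e k\<close> on \<open>ketbra (u k) (u k)\<close>.\<close>
  define lam where "lam = (\<lambda>k. (norm (u k))\<^sup>2 / e k)"
  define lam' where "lam' = (\<lambda>k. (norm (u k))\<^sup>2 / N)"
  have lam: "lam k *\<^sub>R ketbra (\<psi> k) (\<psi> k) = (1 / e k) *\<^sub>R ketbra (u k) (u k)"
    and lam': "lam' k *\<^sub>R ketbra (\<psi> k) (\<psi> k) = (1 / N) *\<^sub>R ketbra (u k) (u k)" if "k \<in> K" for k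
    using u_nz[OF that] by (simp_all add: \<psi>_def lam_def lam'_def ketbra_scaleR power_divide)
  have in_K: "(i, j) \<in> K" if "i \<in> ?I" "j \<in> {1..r i}" for i j
    using that by (simp add: K_def)
  have dec: "p i *\<^sub>R \<rho> i = (\<Sum>j\<in>{1..r i}. lam (i, j) *\<^sub>R ketbra (\<psi> (i, j)) (\<psi> (i, j)))"
    if "i \<in> ?I" for i
  proof -
    have "A i = (\<Sum>j\<in>{1..r i}. lam (i, j) *\<^sub>R ketbra (\<psi> (i, j)) (\<psi> (i, j)))"
      unfolding A_u[OF that] using that by (intro sum.cong refl) (simp add: lam in_K)
    then show ?thesis by (simp add: A_def)
  qed
  have dec': "q i *\<^sub>R \<sigma> i = (\<Sum>j\<in>{1..r i}. lam' (i, j) *\<^sub>R ketbra (\<psi> (i, j)) (\<psi> (i, j)))"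
    if "i \<in> ?I" for i
    unfolding q_eq[OF that] scaleR_sum_right using that by (intro sum.cong refl) (simp add: lam' in_K)
  have unit: "norm (\<psi> k) = 1" if "k \<in> K" for k
    using u_nz[OF that] by (simp add: \<psi>_def)
  have lam_pos: "lam k > 0" if "k \<in> K" for k
    using u_nz[OF that] e_pos[OF that] by (simp add: lam_def)
  have sum_lam: "(\<Sum>k\<in>K. lam k) = 1"
  proof -
    \<comment> \<open>Compare traces in the decomposition of
      \<open>p i *\<^sub>R \<rho> i\<close>.\<close>
    have "(\<Sum>j\<in>{1..r i}. lam (i, j)) = p i" if i: "i \<in> ?I" for i
    proof -
      have "(\<Sum>j\<in>{1..r i}. lam (i, j)) = Re (trace (\<Sum>j\<in>{1..r i}. lam (i, j) *\<^sub>R ketbra (\<psi> (i, j)) (\<psi> (i, j))))"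
        using i by (simp add: trace_sum trace_scaleR trace_ketbra cinner_self unit in_K)
      also have "\<dots> = p i"
        unfolding dec[OF i, symmetric] by (simp add: trace_scaleR tr\<rho>[OF i])
      finally show ?thesis .
    qed
    then show ?thesis by (simp add: sumKR sump)
  qed
  then have "K \<noteq> {}" by auto
  then have N: "N > 0"
    unfolding N_def using finK u_nz by (intro sum_pos) auto
  have lam'_pos: "lam' k > 0" if "k \<in> K" for k
    using u_nz[OF that] N by (simp add: lam'_def)
  have sum_lam': "(\<Sum>k\<in>K. lam' k) = 1"
    using N by (simp add: lam'_def N_def flip: sum_divide_distrib)
  have \<psi>_indep: "independent_family K \<psi>"
  proof (rule independent_familyI[OF finK])
    fix c assume "(\<Sum>k\<in>K. c k *s \<psi> k) = 0"
    then have "(\<Sum>k\<in>K. (c k * of_real (1 / norm (u k))) *s u k) = 0"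
      by (simp only: \<psi>_def scaleR_eq_scale vector_smult_assoc)
    from u_indep[OF this] show "\<forall>k\<in>K. c k = 0"
      using u_nz by auto
  qed

  \<comment> \<open>Optimality and uniqueness for the refined ensemble\<close>
  have cert': "optimality_certificate K (\<lambda>k. lam k *\<^sub>R ketbra (\<psi> k) (\<psi> k)) (\<lambda>k. ketbra (W k) (W k)) Z"
    unfolding optimality_certificate_def
  proof (intro conjI ballI)
    show "POVM K (\<lambda>k. ketbra (W k) (W k))"
      by (simp add: POVM_def psd_ketbra res)
    have "(lam k *\<^sub>R ketbra (\<psi> k) (\<psi> k)) ** ketbra (W k) (W k) = Z ** ketbra (W k) (W k)"
      if k: "k \<in> K" for k
    proof -
      have "((1 / e k) *\<^sub>R ketbra (u k) (u k)) *v W k = u k"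
        using e_pos[OF k] by (simp add: scaleR_matrix_mult_vec ketbra_mult_vec e')
      then show ?thesis
        unfolding lam[OF k] matrix_mult_ketbra by (simp add: u_def)
    qed
    then have "(\<Sum>k\<in>K. (lam k *\<^sub>R ketbra (\<psi> k) (\<psi> k)) ** ketbra (W k) (W k))
        = Z ** (\<Sum>k\<in>K. ketbra (W k) (W k))"
      by (simp add: matrix_sum_ldistrib)
    then show "(\<Sum>k\<in>K. (lam k *\<^sub>R ketbra (\<psi> k) (\<psi> k)) ** ketbra (W k) (W k)) = Z"
      by (simp add: res)
    fix k assume k: "k \<in> K"
    obtain i j where ij: "k = (i, j)" "i \<in> ?I" "j \<in> {1..r i}"
      using k by (auto simp: K_def)
    let ?a = "\<lambda>j. lam (i, j) *\<^sub>R ketbra (\<psi> (i, j)) (\<psi> (i, j))"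
    \<comment> \<open>Passing from \<open>A i\<close> to one of its terms drops only positive
      semidefinite summands, so domination by \<open>Z\<close> survives the refinement.\<close>
    have "A i = ?a j + (\<Sum>j'\<in>{1..r i} - {j}. ?a j')"
      using dec[OF ij(2)] ij(3) by (simp add: A_def sum.remove)
    then have "Z - lam k *\<^sub>R ketbra (\<psi> k) (\<psi> k) = (Z - A i) + (\<Sum>j'\<in>{1..r i} - {j}. ?a j')"
      by (simp add: ij(1))
    moreover have "psd (Z - A i)"
      using cert ij by (simp add: optimality_certificate_def)
    moreover have "psd (\<Sum>j'\<in>{1..r i} - {j}. ?a j')"
      using lam_pos in_K ij by (intro psd_sum psd_scaleR psd_ketbra) (auto intro: less_imp_le)
    ultimately show "psd (Z - lam k *\<^sub>R ketbra (\<psi> k) (\<psi> k))"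
      by (simp only: psd_add)
  qed
  have indep': "independent_ranges K (\<lambda>k. lam k *\<^sub>R ketbra (\<psi> k) (\<psi> k))"
    unfolding independent_ranges_def
  proof (intro allI impI)
    fix x assume 0: "(\<Sum>k\<in>K. (lam k *\<^sub>R ketbra (\<psi> k) (\<psi> k)) *v x k) = 0"
    have a: "(lam k *\<^sub>R ketbra (\<psi> k) (\<psi> k)) *v x k = (of_real (1 / e k) * cinner (u k) (x k)) *s u k"
      if "k \<in> K" for k
      unfolding lam[OF that] by (simp add: scaleR_matrix_mult_vec ketbra_mult_vec)
    have "(\<Sum>k\<in>K. (of_real (1 / e k) * cinner (u k) (x k)) *s u k) = 0"
      using 0 by (simp only: a cong: sum.cong)
    from u_indep[OF this] have "(lam k *\<^sub>R ketbra (\<psi> k) (\<psi> k)) *v x k = 0 *s u k" if "k \<in> K" for k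
      unfolding a[OF that] using that by simp
    then show "\<forall>k\<in>K. (lam k *\<^sub>R ketbra (\<psi> k) (\<psi> k)) *v x k = 0"
      by simp
  qed
  have opt: "the_optimal_POVM K lam (\<lambda>k. ketbra (\<psi> k) (\<psi> k)) (\<lambda>k. ketbra (W k) (W k))"
    by (rule certificate_imp_the_optimal[OF finK cert' indep' inj])

  \<comment> \<open>The pretty good measurement\<close>
  have pgm: "PGM K lam' (\<lambda>k. ketbra (\<psi> k) (\<psi> k)) k = ketbra (W k) (W k)" if k: "k \<in> K" for k
  proof (rule PGM_eqI[where C = "(1 / sqrt N) *\<^sub>R Z"])
    show "psd ((1 / sqrt N) *\<^sub>R Z)"
      using N by (intro psd_scaleR psdZ) simp
    show "x = 0" if "((1 / sqrt N) *\<^sub>R Z) *v x = 0" for x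
      using that N by - (rule inj, simp add: scaleR_matrix_mult_vec)
    show "(\<Sum>k\<in>K. ketbra (W k) (W k)) = mat 1" by (rule res)
    show "lam' k *\<^sub>R ketbra (\<psi> k) (\<psi> k) = (1 / sqrt N) *\<^sub>R Z ** ketbra (W k) (W k) ** (1 / sqrt N) *\<^sub>R Z"
      if "k \<in> K" for k
      unfolding lam'[OF that] scaleR_matrix_mult_left scaleR_matrix_mult_right
      using N by (simp add: matrix_mult_ketbra ketbra_matrix_mult hermZ u_def)
  qed (rule k)
  have opt': "the_optimal_POVM K lam (\<lambda>k. ketbra (\<psi> k) (\<psi> k)) (PGM K lam' (\<lambda>k. ketbra (\<psi> k) (\<psi> k)))"
    by (rule the_optimal_POVM_cong[OF opt pgm])
  have MW': "\<forall>i\<in>?I. M i = (\<Sum>j\<in>{1..r i}. ketbra (W (i, j)) (W (i, j)))"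
    using MW by (simp add: W_def)
  show ?thesis
    unfolding Let_def K_def[symmetric]
    by (intro exI[of _ \<psi>] exI[of _ lam] exI[of _ lam'] conjI ballI exI[of _ W])
      (use \<psi>_indep unit lam_pos lam'_pos sum_lam sum_lam' dec dec' opt MW' opt' in auto)
qed

end
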